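(* Let $B_1\subset\mathbb{R}^2$ be the open unit ball. There exists a Lipschitz function $u:B_1\to\mathbb{R}$, subharmonic in the distributional sense ($\Delta u\ge0$), such that $u\in W^{2,1}(B_1)$ but $$(\partial_{ii}u)_-\notin L^q(\Omega')\quad\text{for every } q>1,\ \text{for } i=1,2,$$ for every nonempty open subset $\Omega'\subset B_1$.
   Context: For a function $f$, $f_-=\max(-f,0)$ denotes its negative part; $\partial_{ii}u$ denotes the weak pure second derivatives of $u$. *)

theory Defs
  imports "HOL-Analysis.Analysis"
begin

definition partial_deriv :: "'n::finite \<Rightarrow> (real^'n \<Rightarrow> real) \<Rightarrow> real^'n \<Rightarrow> real" where
  "partial_deriv i f x = frechet_derivative f (at x) (axis i 1)"

text \<open>A multi-index is written as the list of the coordinate directions in which one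
  differentiates, so its order is the length of the list.\<close>

definition iter_partial :: "'n::finite list \<Rightarrow> (real^'n \<Rightarrow> real) \<Rightarrow> real^'n \<Rightarrow> real" where
  "iter_partial a f = foldr partial_deriv a f"

text \<open>If every iterated partial derivative is differentiable everywhere, then every one is
  continuous, so this is the class of infinitely differentiable functions.\<close>

definition smooth :: "(real^'n::finite \<Rightarrow> real) \<Rightarrow> bool" where
  "smooth f \<longleftrightarrow> (\<forall>a x. iter_partial a f differentiable (at x))"

definition test_function :: "(real^'n::finite) set \<Rightarrow> (real^'n \<Rightarrow> real) \<Rightarrow> bool" where
  "test_function \<Omega> \<phi> \<longleftrightarrow>
     smooth \<phi> \<and> compact (closure {x. \<phi> x \<noteq> 0}) \<and> closure {x. \<phi> x \<noteq> 0} \<subseteq> \<Omega>"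

definition loc_integrable :: "(real^'n::finite) set \<Rightarrow> (real^'n \<Rightarrow> real) \<Rightarrow> bool" where
  "loc_integrable \<Omega> f \<longleftrightarrow> (\<forall>K. compact K \<and> K \<subseteq> \<Omega> \<longrightarrow> integrable (lebesgue_on K) f)"

definition in_Lp :: "(real^'n::finite) set \<Rightarrow> real \<Rightarrow> (real^'n \<Rightarrow> real) \<Rightarrow> bool" where
  "in_Lp \<Omega> p f \<longleftrightarrow> f \<in> borel_measurable (lebesgue_on \<Omega>) \<and>
     integrable (lebesgue_on \<Omega>) (\<lambda>x. \<bar>f x\<bar> powr p)"

text \<open>The function \<open>g\<close> is a version of the weak derivative of \<open>f\<close>; versions are unique
  up to null sets.\<close>

definition weak_deriv ::
  "(real^'n::finite) set \<Rightarrow> 'n list \<Rightarrow> (real^'n \<Rightarrow> real) \<Rightarrow> (real^'n \<Rightarrow> real) \<Rightarrow> bool" where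
  "weak_deriv \<Omega> a f g \<longleftrightarrow> loc_integrable \<Omega> f \<and> loc_integrable \<Omega> g \<and>
     (\<forall>\<phi>. test_function \<Omega> \<phi> \<longrightarrow>
        (LINT x|lebesgue_on \<Omega>. f x * iter_partial a \<phi> x)
          = (- 1) ^ length a * (LINT x|lebesgue_on \<Omega>. g x * \<phi> x))"

definition sobolev ::
  "nat \<Rightarrow> real \<Rightarrow> (real^'n::finite) set \<Rightarrow> (real^'n \<Rightarrow> real) \<Rightarrow> bool" where
  "sobolev k p \<Omega> f \<longleftrightarrow> in_Lp \<Omega> p f \<and>
     (\<forall>a. length a \<le> k \<longrightarrow> (\<exists>g. weak_deriv \<Omega> a f g \<and> in_Lp \<Omega> p g))"

definition laplacian :: "(real^'n::finite \<Rightarrow> real) \<Rightarrow> real^'n \<Rightarrow> real" where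
  "laplacian f x = (\<Sum>i\<in>UNIV. iter_partial [i, i] f x)"

definition distr_subharmonic :: "(real^'n::finite) set \<Rightarrow> (real^'n \<Rightarrow> real) \<Rightarrow> bool" where
  "distr_subharmonic \<Omega> u \<longleftrightarrow> loc_integrable \<Omega> u \<and>
     (\<forall>\<phi>. test_function \<Omega> \<phi> \<and> (\<forall>x. 0 \<le> \<phi> x) \<longrightarrow>
        0 \<le> (LINT x|lebesgue_on \<Omega>. u x * laplacian \<phi> x))"

definition neg_part :: "('a \<Rightarrow> real) \<Rightarrow> 'a \<Rightarrow> real" where
  "neg_part f x = max (- f x) 0"

end

theory Submission
  imports Defs
begin

text \<open>
  The function is a superposition \<open>u = \<Sum>m. amp m * block (d m) (t m) (width m)\<close> of smooth blocks.
  With \<open>s = (y - t) / r\<close>, a block of width \<open>r\<close> around the line \<open>y = t\<close> is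
  \<open>r * (7 * lor_prim s + cos (x / r) * lor s)\<close>, where \<open>lor s = 1 / (1 + s\<^sup>2)\<close> and
  \<open>lor_prim'' = lor\<close>. The convex first summand depends on \<open>y\<close> alone; the second is a ripple along
  the line whose wavelength is comparable to the width of the profile. The ripple makes
  \<open>\<partial>\<^sub>x\<^sub>x = - cos (x / r) * lor s / r\<close> as negative as \<open>- 1 / r\<close>, on a set of area of order \<open>r\<close>,
  while the convex part compensates for it in \<open>\<partial>\<^sub>y\<^sub>y\<close>, so that the block is subharmonic.
  Uniformly in \<open>r\<close>, a block is Lipschitz and its second derivatives are at most \<open>13 * lor s / r\<close>,
  whose integral over the ball is bounded. Hence the superposition is Lipschitz, subharmonic and in
  \<open>W\<^sup>2\<^sup>,\<^sup>1\<close> as soon as the amplitudes are summable. Its weak derivatives are the sums of the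
  derivatives of the blocks, because derivatives of smooth functions are weak derivatives
  (\<open>weak_deriv_smooth\<close>) and weak derivatives pass to sums that converge absolutely in \<open>L\<^sup>1\<close>
  (\<open>weak_deriv_suminf\<close>).

  Each direction and each line with rational \<open>t\<close> is used by infinitely many blocks. Given an open set,
  such a line meets it, and for a block \<open>k\<close> on that line one tests the second derivative
  against \<open>probe\<close>, which is a cutoff times \<open>1 + cos (x / r)\<close> supported on the strip of width
  \<open>r = width k\<close>. Block \<open>k\<close> contributes at most \<open>- c * amp k\<close> with \<open>c > 0\<close> independent of \<open>k\<close>, up to
  a relative error of order \<open>r\<close>. The earlier blocks, whose second derivatives are bounded, contribute
  little because the strip is thin; the later ones contribute little because their amplitudes have a
  small sum. If the negative part were in \<open>L\<^sup>q\<close>, the same integral would be at least minus a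
  constant times a positive power of \<open>r\<close>. Since \<open>width k\<close> tends to zero faster than every power of
  \<open>amp k\<close>, this is impossible.
\<close>

section \<open>Smooth functions of one variable\<close>

primrec times_diff :: "nat \<Rightarrow> (real \<Rightarrow> real) \<Rightarrow> bool" where
  "times_diff 0 f = True"
| "times_diff (Suc n) f =
     (\<exists>f'. (\<forall>x. (f has_real_derivative f' x) (at x)) \<and> times_diff n f')"

definition smooth1 :: "(real \<Rightarrow> real) \<Rightarrow> bool" where
  "smooth1 f \<longleftrightarrow> (\<forall>n. times_diff n f)"

lemma times_diff_SucD: "times_diff (Suc n) f \<Longrightarrow> times_diff n f"
  by (induction n arbitrary: f) auto

lemma smooth1_obtain_deriv:
  assumes "smooth1 f"
  obtains f' where "\<And>x. (f has_real_derivative f' x) (at x)" "smooth1 f'"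
proof -
  have "times_diff (Suc 0) f"
    using assms unfolding smooth1_def by blast
  then obtain f' where f': "\<And>x. (f has_real_derivative f' x) (at x)"
    by auto
  have "times_diff n f'" for n
  proof -
    have "times_diff (Suc n) f"
      using assms unfolding smooth1_def by blast
    then obtain g where g: "\<And>x. (f has_real_derivative g x) (at x)" "times_diff n g"
      by auto
    have "g = f'"
      using DERIV_unique[OF g(1) f'] by blast
    with g show ?thesis by simp
  qed
  with f' that show ?thesis
    unfolding smooth1_def by blast
qed

lemma smooth1I:
  assumes "\<And>x. (f has_real_derivative f' x) (at x)" "smooth1 f'"
  shows "smooth1 f"
  unfolding smooth1_def
proof
  fix n show "times_diff n f"
    using assms unfolding smooth1_def by (cases n) auto
qed

lemma smooth1_continuous: "smooth1 f \<Longrightarrow> continuous_on UNIV f"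
  by (metis smooth1_obtain_deriv DERIV_isCont continuous_at_imp_continuous_on)

lemma times_diff_const: "times_diff n (\<lambda>x. c)"
proof (induction n arbitrary: c)
  case (Suc n)
  have "\<forall>x. ((\<lambda>x. c) has_real_derivative 0) (at x)" by simp
  with Suc[of 0] show ?case
    unfolding times_diff.simps by (intro exI[of _ "\<lambda>_. 0"] conjI)
qed auto

lemma smooth1_const [simp]: "smooth1 (\<lambda>x. c)"
  unfolding smooth1_def using times_diff_const by blast

lemma smooth1_ident [simp]: "smooth1 (\<lambda>x. x)"
  by (rule smooth1I[where f' = "\<lambda>_. 1"]) auto

lemma times_diff_add: "times_diff n f \<Longrightarrow> times_diff n g \<Longrightarrow> times_diff n (\<lambda>x. f x + g x)"
proof (induction n arbitrary: f g)
  case (Suc n)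
  then obtain f' g' where
    d: "\<And>x. (f has_real_derivative f' x) (at x)" "\<And>x. (g has_real_derivative g' x) (at x)"
    and n: "times_diff n f'" "times_diff n g'"
    by auto
  have "((\<lambda>x. f x + g x) has_real_derivative f' x + g' x) (at x)" for x
    using d by (intro DERIV_add)
  with Suc.IH[OF n] show ?case
    unfolding times_diff.simps by (intro exI[of _ "\<lambda>x. f' x + g' x"] conjI allI)
qed auto

lemma times_diff_mult: "times_diff n f \<Longrightarrow> times_diff n g \<Longrightarrow> times_diff n (\<lambda>x. f x * g x)"
proof (induction n arbitrary: f g)
  case (Suc n)
  then obtain f' g' where
    d: "\<And>x. (f has_real_derivative f' x) (at x)" "\<And>x. (g has_real_derivative g' x) (at x)"
    and n: "times_diff n f'" "times_diff n g'"
    by auto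
  have "((\<lambda>x. f x * g x) has_real_derivative f' x * g x + f x * g' x) (at x)" for x
    using DERIV_mult[OF d(1)[of x] d(2)[of x]] by (simp add: algebra_simps)
  moreover have "times_diff n (\<lambda>x. f' x * g x + f x * g' x)"
    using Suc.IH[OF n(1) times_diff_SucD[OF Suc.prems(2)]]
      Suc.IH[OF times_diff_SucD[OF Suc.prems(1)] n(2)] by (rule times_diff_add)
  ultimately show ?case
    unfolding times_diff.simps by (intro exI[of _ "\<lambda>x. f' x * g x + f x * g' x"] conjI allI)
qed auto

lemma times_diff_compose: "times_diff n f \<Longrightarrow> times_diff n g \<Longrightarrow> times_diff n (\<lambda>x. f (g x))"
proof (induction n arbitrary: f g)
  case (Suc n)
  then obtain f' g' where
    d: "\<And>x. (f has_real_derivative f' x) (at x)" "\<And>x. (g has_real_derivative g' x) (at x)"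
    and n: "times_diff n f'" "times_diff n g'"
    by auto
  have "((\<lambda>x. f (g x)) has_real_derivative f' (g x) * g' x) (at x)" for x
    using DERIV_chain2[OF d(1) d(2)] .
  moreover have "times_diff n (\<lambda>x. f' (g x) * g' x)"
    using Suc.IH[OF n(1) times_diff_SucD[OF Suc.prems(2)]] n(2) by (rule times_diff_mult)
  ultimately show ?case
    unfolding times_diff.simps by (intro exI[of _ "\<lambda>x. f' (g x) * g' x"] conjI allI)
qed auto

lemma smooth1_add:
  assumes "smooth1 f" "smooth1 g"
  shows "smooth1 (\<lambda>x. f x + g x)"
  using assms unfolding smooth1_def by (intro allI times_diff_add) auto

lemma smooth1_mult:
  assumes "smooth1 f" "smooth1 g"
  shows "smooth1 (\<lambda>x. f x * g x)"
  using assms unfolding smooth1_def by (intro allI times_diff_mult) auto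

lemma smooth1_compose:
  assumes "smooth1 f" "smooth1 g"
  shows "smooth1 (\<lambda>x. f (g x))"
  using assms unfolding smooth1_def by (intro allI times_diff_compose[of _ f g]) auto

lemma smooth1_affine: "smooth1 (\<lambda>x. (x - c) / r)"
proof -
  have "(\<lambda>x. (x - c) / r) = (\<lambda>x. x * (1 / r) + (- c / r))"
    by (simp add: diff_divide_distrib)
  moreover have "smooth1 (\<lambda>x. x * (1 / r) + (- c / r))"
    by (intro smooth1_add smooth1_mult smooth1_ident smooth1_const)
  ultimately show ?thesis by metis
qed

lemma smooth1_rescale:
  assumes "smooth1 f"
  shows "smooth1 (\<lambda>x. f ((x - c) / r))"
  using smooth1_compose[OF assms smooth1_affine] .

lemma times_diff_sin_cos: "times_diff n (\<lambda>x. \<alpha> * sin x + \<beta> * cos x)"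
proof (induction n arbitrary: \<alpha> \<beta>)
  case (Suc n)
  have "\<forall>x. ((\<lambda>x. \<alpha> * sin x + \<beta> * cos x) has_real_derivative (- \<beta>) * sin x + \<alpha> * cos x) (at x)"
    by (auto intro!: derivative_eq_intros)
  moreover have "times_diff n (\<lambda>x. (- \<beta>) * sin x + \<alpha> * cos x)"
    by (rule Suc)
  ultimately show ?case
    unfolding times_diff.simps by (intro exI conjI)
qed auto

lemma smooth1_sin: "smooth1 sin" and smooth1_cos: "smooth1 cos"
  unfolding smooth1_def
  using times_diff_sin_cos[of _ 1 0] times_diff_sin_cos[of _ 0 1] by simp_all

text \<open>The factors \<open>(1 / t) ^ m\<close> make the family of these functions closed under differentiation,
  up to linear combinations; that is what proves smoothness at \<open>0\<close>.\<close>

definition flat :: "nat \<Rightarrow> real \<Rightarrow> real" where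
  "flat m t = (if t > 0 then (1 / t) ^ m * exp (- (1 / t)) else 0)"

lemma flat_tendsto_0: "(flat m \<longlongrightarrow> 0) (at_right 0)"
proof -
  have "((\<lambda>t::real. inverse t ^ m / exp (inverse t)) \<longlongrightarrow> 0) (at_right 0)"
    by (rule filterlim_compose[OF tendsto_power_div_exp_0 filterlim_inverse_at_top_right])
  then show ?thesis
  proof (rule tendsto_cong[THEN iffD1, rotated])
    show "\<forall>\<^sub>F t in at_right 0. inverse t ^ m / exp (inverse t) = flat m t"
      unfolding eventually_at_right_field flat_def
      by (intro exI[of _ 1]) (auto simp: exp_minus field_simps)
  qed
qed

lemma flat_deriv:
  "(flat m has_real_derivative - real m * flat (Suc m) t + flat (Suc (Suc m)) t) (at t)"
proof -
  consider "t > 0" | "t < 0" | "t = 0" by linarith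
  then show ?thesis
  proof cases
    case 1
    have d: "((\<lambda>t. 1 / t) has_real_derivative - ((1 / t) ^ 2)) (at t)"
      using 1 by (auto intro!: derivative_eq_intros simp: power2_eq_square)
    have "((\<lambda>t. (1 / t) ^ m * exp (- (1 / t))) has_real_derivative
        real m * (1 / t) ^ (m - 1) * - ((1 / t) ^ 2) * exp (- (1 / t))
        + (1 / t) ^ m * (exp (- (1 / t)) * (1 / t) ^ 2)) (at t)"
      by (rule derivative_eq_intros d refl | simp)+
    also have "real m * (1 / t) ^ (m - 1) * - ((1 / t) ^ 2) * exp (- (1 / t))
        + (1 / t) ^ m * (exp (- (1 / t)) * (1 / t) ^ 2)
      = - real m * flat (Suc m) t + flat (Suc (Suc m)) t"
      using 1 by (cases m) (simp_all add: flat_def power2_eq_square, simp add: divide_simps algebra_simps)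
    finally have "((\<lambda>t. (1 / t) ^ m * exp (- (1 / t))) has_real_derivative
        - real m * flat (Suc m) t + flat (Suc (Suc m)) t) (at t)" .
    moreover have "\<forall>\<^sub>F x in nhds t. (1 / x) ^ m * exp (- (1 / x)) = flat m x"
      using eventually_nhds_in_open[of "{0<..}" t] 1
      by (auto elim!: eventually_mono simp: flat_def)
    ultimately show ?thesis
      by (rule DERIV_cong_ev[OF refl _ refl, THEN iffD1, rotated])
  next
    case 2
    have ev: "\<forall>\<^sub>F x in nhds t. 0 = flat m x"
      using eventually_nhds_in_open[of "{..<0}" t] 2
      by (auto elim!: eventually_mono simp: flat_def)
    have "((\<lambda>t::real. 0::real) has_real_derivative
        - real m * flat (Suc m) t + flat (Suc (Suc m)) t) (at t)"
      using 2 by (auto simp: flat_def)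
    then show ?thesis
      by (rule DERIV_cong_ev[OF refl ev refl, THEN iffD1])
  next
    case 3
    have r: "((\<lambda>h. (flat m h - flat m 0) / (h - 0)) \<longlongrightarrow> 0) (at_right 0)"
      using flat_tendsto_0[of "Suc m"]
    proof (rule tendsto_cong[THEN iffD1, rotated])
      show "\<forall>\<^sub>F h in at_right 0. flat (Suc m) h = (flat m h - flat m 0) / (h - 0)"
        unfolding eventually_at_right_field flat_def
        by (intro exI[of _ 1]) (auto simp: field_simps)
    qed
    have l: "((\<lambda>h. (flat m h - flat m 0) / (h - 0)) \<longlongrightarrow> 0) (at_left 0)"
      using tendsto_const[of "0::real" "at_left 0"]
    proof (rule tendsto_cong[THEN iffD1, rotated])
      show "\<forall>\<^sub>F h in at_left 0. 0 = (flat m h - flat m 0) / (h - 0)"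
        unfolding eventually_at_left_field flat_def
        by (intro exI[of _ "-1"]) auto
    qed
    have "(flat m has_real_derivative 0) (at 0)"
      unfolding has_field_derivative_iff using filterlim_split_at[OF l r] .
    with 3 show ?thesis by (simp add: flat_def)
  qed
qed

lemma smooth1_flat: "smooth1 (flat m)"
  unfolding smooth1_def
proof
  fix n show "times_diff n (flat m)"
  proof (induction n arbitrary: m)
    case (Suc n)
    have "times_diff n (\<lambda>t. - real m * flat (Suc m) t + flat (Suc (Suc m)) t)"
      by (intro times_diff_add times_diff_mult times_diff_const Suc)
    then show ?case
      unfolding times_diff.simps by (intro exI conjI allI) (rule flat_deriv)
  qed auto
qed

definition bump :: "real \<Rightarrow> real" where
  "bump t = flat 0 (1 + t) * flat 0 (1 - t)"

lemma smooth1_bump: "smooth1 bump"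
proof -
  have "smooth1 (\<lambda>t. flat 0 ((t - (-1)) / 1))" "smooth1 (\<lambda>t. flat 0 ((t - 1) / (-1)))"
    by (intro smooth1_rescale smooth1_flat)+
  from smooth1_mult[OF this] show ?thesis
    unfolding bump_def[abs_def] by (simp add: add.commute)
qed

lemma bump_nonneg: "0 \<le> bump t" and bump_le_1: "bump t \<le> 1"
proof -
  have "0 \<le> flat 0 s \<and> flat 0 s \<le> 1" for s by (simp add: flat_def)
  then show "0 \<le> bump t" "bump t \<le> 1"
    unfolding bump_def by (auto intro: mult_le_one)
qed

lemma bump_eq_0: "1 \<le> \<bar>t\<bar> \<Longrightarrow> bump t = 0"
  unfolding bump_def flat_def by auto

lemma bump_ge:
  assumes "\<bar>t\<bar> \<le> 1 / 2"
  shows "exp (- 4) \<le> bump t"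
proof -
  have *: "exp (- 2) \<le> flat 0 s" if "1 / 2 \<le> s" for s :: real
    using that by (simp add: flat_def field_simps)
  have "exp (- 4) = exp (- 2) * exp (- 2 :: real)" by (simp flip: exp_add)
  also have "\<dots> \<le> bump t"
    unfolding bump_def using assms by (intro mult_mono *) (auto simp: flat_def)
  finally show ?thesis .
qed

section \<open>Partial derivatives and integration by parts\<close>

lemma iter_partial_Nil [simp]: "iter_partial [] f = f"
  and iter_partial_Cons: "iter_partial (i # a) f = partial_deriv i (iter_partial a f)"
  and iter_partial_append: "iter_partial (a @ b) f = iter_partial a (iter_partial b f)"
  by (simp_all add: iter_partial_def)

lemma smooth_iter_partial: "smooth f \<Longrightarrow> smooth (iter_partial a f)"
  unfolding smooth_def by (simp flip: iter_partial_append)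

lemma smooth_partial_deriv: "smooth f \<Longrightarrow> smooth (partial_deriv i f)"
  using smooth_iter_partial[of f "[i]"] by (simp add: iter_partial_Cons)

lemma smooth_differentiable: "smooth f \<Longrightarrow> f differentiable (at x)"
  unfolding smooth_def by (metis iter_partial_Nil)

lemma smooth_continuous: "smooth f \<Longrightarrow> continuous_on S f"
  using smooth_differentiable differentiable_imp_continuous_within
  by (metis continuous_at_imp_continuous_on)

lemma partial_deriv_eqI:
  "(f has_derivative f') (at x) \<Longrightarrow> partial_deriv i f x = f' (axis i 1)"
  unfolding partial_deriv_def by (metis frechet_derivative_at)

lemma differentiable_has_derivative:
  "f differentiable (at x) \<Longrightarrow> (f has_derivative frechet_derivative f (at x)) (at x)"
  by (simp add: frechet_derivative_works)

lemma partial_deriv_along_line: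
  fixes f :: "real^'n::finite \<Rightarrow> real"
  assumes "\<And>x. f differentiable (at x)"
  shows "((\<lambda>t. f (x + t *\<^sub>R axis i 1)) has_real_derivative
           partial_deriv i f (x + s *\<^sub>R axis i 1)) (at s)"
proof -
  have "((\<lambda>t. x + t *\<^sub>R axis i 1) has_derivative (\<lambda>t. t *\<^sub>R axis i 1)) (at s)"
    by (auto intro!: derivative_eq_intros)
  from has_derivative_compose[OF this differentiable_has_derivative[OF assms]]
  have "((\<lambda>t. f (x + t *\<^sub>R axis i 1)) has_derivative
      (\<lambda>t. frechet_derivative f (at (x + s *\<^sub>R axis i 1)) (t *\<^sub>R axis i 1))) (at s)" .
  moreover have "frechet_derivative f (at (x + s *\<^sub>R axis i 1)) (t *\<^sub>R axis i 1)
      = partial_deriv i f (x + s *\<^sub>R axis i 1) * t" for t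
    using linear_frechet_derivative[OF assms[of "x + s *\<^sub>R axis i 1"]]
    by (simp add: partial_deriv_def linear_cmul)
  ultimately show ?thesis
    by (simp add: has_field_derivative_def)
qed

lemma partial_deriv_add:
  assumes "f differentiable (at x)" "g differentiable (at x)"
  shows "partial_deriv i (\<lambda>x. f x + g x) x = partial_deriv i f x + partial_deriv i g x"
  using partial_deriv_eqI[OF has_derivative_add[OF assms[THEN differentiable_has_derivative]]]
  by (simp add: partial_deriv_def)

lemma partial_deriv_mult:
  assumes "f differentiable (at x)" "g differentiable (at x)"
  shows "partial_deriv i (\<lambda>x. f x * g x) x = f x * partial_deriv i g x + partial_deriv i f x * g x"
  using partial_deriv_eqI[OF has_derivative_mult[OF assms[THEN differentiable_has_derivative]]]
  by (simp add: partial_deriv_def)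

lemma iter_partial_add:
  assumes "smooth f" "smooth g"
  shows "iter_partial a (\<lambda>x. f x + g x) = (\<lambda>x. iter_partial a f x + iter_partial a g x)"
proof (induction a)
  case (Cons i a)
  show ?case
    using assms by (auto simp: iter_partial_Cons Cons fun_eq_iff
        intro!: partial_deriv_add smooth_differentiable smooth_iter_partial)
qed auto

lemma smooth_add:
  assumes "smooth f" "smooth g"
  shows "smooth (\<lambda>x. f x + g x)"
  unfolding smooth_def
  unfolding iter_partial_add[OF assms]
  by (intro allI differentiable_add smooth_differentiable smooth_iter_partial assms)

lemma partial_deriv_eq_0_outside:
  fixes f :: "real^'n::finite \<Rightarrow> real"
  assumes "closed K" "\<And>x. x \<notin> K \<Longrightarrow> f x = 0" "x \<notin> K"
  shows "partial_deriv i f x = 0"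
proof -
  have "(f has_derivative (\<lambda>_. 0)) (at x)"
    by (rule has_derivative_transform_within_open[of "\<lambda>_. 0" _ _ _ "- K"])
       (use assms in \<open>auto simp: open_Compl\<close>)
  then show ?thesis by (rule partial_deriv_eqI)
qed

lemma iter_partial_eq_0_outside:
  fixes f :: "real^'n::finite \<Rightarrow> real"
  assumes "closed K" "\<And>x. x \<notin> K \<Longrightarrow> f x = 0" "x \<notin> K"
  shows "iter_partial a f x = 0"
  using assms(3)
  by (induction a arbitrary: x) (auto simp: iter_partial_Cons assms intro: partial_deriv_eq_0_outside[OF assms(1)])

lemma integrable_compact_support:
  fixes h :: "'a::euclidean_space \<Rightarrow> real"
  assumes "continuous_on UNIV h" "compact K" "\<And>x. x \<notin> K \<Longrightarrow> h x = 0"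
  shows "integrable lborel h"
proof -
  have "integrable lborel (\<lambda>x. indicator K x *\<^sub>R h x)"
    using assms by (intro borel_integrable_compact) (auto intro: continuous_on_subset)
  also have "(\<lambda>x. indicator K x *\<^sub>R h x) = h"
    using assms(3) by (auto simp: indicator_def fun_eq_iff)
  finally show ?thesis .
qed

lemma integral_lebesgue_on_compact_support:
  fixes h :: "'a::euclidean_space \<Rightarrow> real"
  assumes "continuous_on UNIV h" "\<Omega> \<in> sets lebesgue" "\<And>x. x \<notin> \<Omega> \<Longrightarrow> h x = 0"
  shows "(LINT x|lebesgue_on \<Omega>. h x) = (LINT x|lborel. h x)"
proof -
  have "(LINT x|lebesgue_on \<Omega>. h x) = (LINT x|lebesgue. indicator \<Omega> x *\<^sub>R h x)"
    using assms(2) by (intro integral_restrict_space) auto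
  also have "(\<lambda>x. indicator \<Omega> x *\<^sub>R h x) = h"
    using assms(3) by (auto simp: indicator_def fun_eq_iff)
  also have "(LINT x|lebesgue. h x) = (LINT x|lborel. h x)"
    using assms(1) by (intro integral_completion) (auto intro: borel_measurable_continuous_onI)
  finally show ?thesis .
qed

lemma integral_lborel_shift:
  fixes F :: "'a::euclidean_space \<Rightarrow> real"
  assumes "F \<in> borel_measurable borel"
  shows "(LINT x|lborel. F (c + x)) = (LINT x|lborel. F x)"
proof -
  have "(LINT x|lborel. F x) = (LINT x|distr lborel borel ((+) c). F x)"
    by (simp add: lborel_distr_plus)
  also have "\<dots> = (LINT x|lborel. F (c + x))"
    using assms by (subst integral_distr) auto
  finally show ?thesis by simp
qed

lemma integrable_lborel_shift:
  fixes F :: "'a::euclidean_space \<Rightarrow> real"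
  assumes "F \<in> borel_measurable borel"
  shows "integrable lborel (\<lambda>x. F (c + x)) \<longleftrightarrow> integrable lborel F"
proof -
  have "integrable lborel F \<longleftrightarrow> integrable (distr lborel borel ((+) c)) F"
    by (simp add: lborel_distr_plus)
  also have "\<dots> \<longleftrightarrow> integrable lborel (\<lambda>x. F (c + x))"
    using assms by (subst integrable_distr_eq) auto
  finally show ?thesis by simp
qed

text \<open>The integral of \<open>F\<close> does not change under translation, so the difference quotients of \<open>F\<close>
  have integral zero; they converge to the partial derivative, and dominatedly so.\<close>

lemma integral_partial_deriv_eq_0:
  fixes F :: "real^'n::finite \<Rightarrow> real"
  assumes diff: "\<And>x. F differentiable (at x)"
    and cont: "continuous_on UNIV (partial_deriv i F)"
    and K: "compact K" "\<And>x. x \<notin> K \<Longrightarrow> F x = 0"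
  shows "(LINT x|lborel. partial_deriv i F x) = 0"
proof -
  let ?e = "axis i 1 :: real^'n"
  define t where "t n = 1 / real (Suc n)" for n
  define q where "q n x = (F (t n *\<^sub>R ?e + x) - F x) / t n" for n x
  \<comment> \<open>All difference quotients of steps in \<open>(0, 1]\<close> vanish outside this set.\<close>
  define K' where "K' = {x + y | x y. x \<in> K \<and> y \<in> cball 0 1}"
  have K': "compact K'"
    unfolding K'_def using K(1) by (intro compact_sums compact_cball)
  have t: "0 < t n" "t n \<le> 1" for n
    by (auto simp: t_def)
  have contF: "continuous_on UNIV F"
    using diff by (intro continuous_at_imp_continuous_on) (auto intro: differentiable_imp_continuous_within)
  have meas [measurable]: "F \<in> borel_measurable borel" "partial_deriv i F \<in> borel_measurable borel"
    using contF cont by (auto intro: borel_measurable_continuous_onI)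
  have intF: "integrable lborel F"
    by (rule integrable_compact_support[OF contF K])
  have D0: "partial_deriv i F x = 0" if "x \<notin> K" for x
    by (rule partial_deriv_eq_0_outside[OF _ K(2) that]) (use K(1) compact_imp_closed in auto)
  have "bounded (partial_deriv i F ` K)"
    using K(1) cont by (intro compact_imp_bounded compact_continuous_image) (auto intro: continuous_on_subset)
  then obtain C where "\<And>x. x \<in> K \<Longrightarrow> \<bar>partial_deriv i F x\<bar> \<le> C" and "0 < C"
    by (auto simp: bounded_pos)
  with D0 have C: "\<bar>partial_deriv i F x\<bar> \<le> C" for x
    by (cases "x \<in> K") auto
  have q_bound: "\<bar>q n x\<bar> \<le> C * indicator K' x" for n x
  proof (cases "x \<in> K'")
    case True
    obtain s where "F (x + t n *\<^sub>R ?e) - F (x + 0 *\<^sub>R ?e)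
        = (t n - 0) * partial_deriv i F (x + s *\<^sub>R ?e)"
      using MVT2[of 0 "t n" "\<lambda>s. F (x + s *\<^sub>R ?e)" "\<lambda>s. partial_deriv i F (x + s *\<^sub>R ?e)"]
        partial_deriv_along_line[OF diff, of x i] t by metis
    then have "q n x = partial_deriv i F (x + s *\<^sub>R ?e)"
      using t[of n] by (simp add: q_def add.commute)
    with C True show ?thesis by simp
  next
    case False
    have "x \<notin> K"
    proof
      assume "x \<in> K"
      then have "x + 0 \<in> K'"
        unfolding K'_def by (intro CollectI exI[of _ x] exI[of _ 0]) auto
      with False show False by simp
    qed
    moreover have "t n *\<^sub>R ?e + x \<notin> K"
    proof
      assume "t n *\<^sub>R ?e + x \<in> K"
      moreover have "x = (t n *\<^sub>R ?e + x) + (- t n *\<^sub>R ?e)" "- t n *\<^sub>R ?e \<in> cball 0 1"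
        using t[of n] by (auto simp: norm_axis_1)
      ultimately have "x \<in> K'"
        unfolding K'_def by blast
      with False show False by simp
    qed
    ultimately show ?thesis
      using False K(2) by (simp add: q_def)
  qed
  have q_lim: "(\<lambda>n. q n x) \<longlonglongrightarrow> partial_deriv i F x" for x
  proof -
    have "((\<lambda>h. (F (x + (0 + h) *\<^sub>R ?e) - F (x + 0 *\<^sub>R ?e)) / h) \<longlongrightarrow> partial_deriv i F (x + 0 *\<^sub>R ?e)) (at 0)"
      using partial_deriv_along_line[OF diff, of x i 0] by (simp only: DERIV_def)
    moreover have "filterlim t (at 0) sequentially"
      unfolding filterlim_at t_def using LIMSEQ_inverse_real_of_nat by (auto simp: field_simps)
    ultimately have "(\<lambda>n. (F (x + (0 + t n) *\<^sub>R ?e) - F (x + 0 *\<^sub>R ?e)) / t n)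
        \<longlonglongrightarrow> partial_deriv i F (x + 0 *\<^sub>R ?e)"
      by (rule filterlim_compose)
    then show ?thesis
      by (simp add: q_def add.commute)
  qed
  have "(LINT x|lborel. q n x) = 0" for n
  proof -
    have "integrable lborel (\<lambda>x. F (t n *\<^sub>R ?e + x))"
      using intF by (simp add: integrable_lborel_shift[OF meas(1)])
    then show ?thesis
      using intF integral_lborel_shift[OF meas(1), of "t n *\<^sub>R ?e"] by (simp add: q_def)
  qed
  moreover have "(\<lambda>n. LINT x|lborel. q n x) \<longlonglongrightarrow> (LINT x|lborel. partial_deriv i F x)"
  proof (rule integral_dominated_convergence)
    show "integrable lborel (\<lambda>x. C * indicator K' x)"
      using K' by (intro integrable_mult_right integrable_real_indicator)
        (use emeasure_bounded_finite[OF compact_imp_bounded[OF K']] in \<open>auto simp: compact_imp_closed\<close>)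
  qed (use q_lim q_bound in \<open>auto simp: q_def\<close>)
  ultimately have "(\<lambda>n. 0) \<longlonglongrightarrow> (LINT x|lborel. partial_deriv i F x)"
    by simp
  then show ?thesis
    by (simp only: LIMSEQ_const_iff)
qed

lemma integration_by_parts:
  fixes w \<psi> :: "real^'n::finite \<Rightarrow> real"
  assumes "smooth w" "smooth \<psi>" "compact K" "\<And>x. x \<notin> K \<Longrightarrow> \<psi> x = 0"
  shows "(LINT x|lborel. w x * partial_deriv i \<psi> x) = - (LINT x|lborel. partial_deriv i w x * \<psi> x)"
proof -
  have diff: "w differentiable (at x)" "\<psi> differentiable (at x)" for x
    using assms by (auto intro: smooth_differentiable)
  have eq: "partial_deriv i (\<lambda>x. w x * \<psi> x)
      = (\<lambda>x. w x * partial_deriv i \<psi> x + partial_deriv i w x * \<psi> x)"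
    using partial_deriv_mult[OF diff] by blast
  have cont: "continuous_on UNIV (\<lambda>x. w x * partial_deriv i \<psi> x)"
    "continuous_on UNIV (\<lambda>x. partial_deriv i w x * \<psi> x)"
    by (intro continuous_intros smooth_continuous smooth_partial_deriv assms)+
  have "partial_deriv i \<psi> x = 0" if "x \<notin> K" for x
    by (rule partial_deriv_eq_0_outside[OF _ assms(4) that]) (use assms compact_imp_closed in auto)
  then have int: "integrable lborel (\<lambda>x. w x * partial_deriv i \<psi> x)"
    "integrable lborel (\<lambda>x. partial_deriv i w x * \<psi> x)"
    using assms by (auto intro!: integrable_compact_support[OF cont(1) assms(3)]
        integrable_compact_support[OF cont(2) assms(3)])
  have "(LINT x|lborel. partial_deriv i (\<lambda>x. w x * \<psi> x) x) = 0"
    using assms diff cont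
    by (intro integral_partial_deriv_eq_0[of _ _ K]) (auto simp: eq intro!: continuous_on_add)
  then show ?thesis
    using int by (simp add: eq)
qed

text \<open>Moving the derivatives over one at a time, the outermost first, reverses their order.\<close>

lemma iterated_integration_by_parts:
  fixes w \<phi> :: "real^'n::finite \<Rightarrow> real"
  assumes "smooth w" "smooth \<phi>" "compact K" "\<And>x. x \<notin> K \<Longrightarrow> \<phi> x = 0"
  shows "(LINT x|lborel. w x * iter_partial a \<phi> x)
    = (- 1) ^ length a * (LINT x|lborel. iter_partial (rev a) w x * \<phi> x)"
  using assms(1)
proof (induction a arbitrary: w)
  case (Cons i a)
  have "(LINT x|lborel. w x * iter_partial (i # a) \<phi> x)
      = - (LINT x|lborel. partial_deriv i w x * iter_partial a \<phi> x)"
    unfolding iter_partial_Cons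
    using assms Cons.prems
    by (intro integration_by_parts[of _ _ K])
       (auto intro: smooth_iter_partial iter_partial_eq_0_outside compact_imp_closed)
  with Cons.IH[OF smooth_partial_deriv[OF Cons.prems, of i]] show ?case
    by (simp add: iter_partial_append iter_partial_Cons)
qed auto

lemma integrable_lebesgue_on_compact:
  fixes f :: "'a::euclidean_space \<Rightarrow> real"
  assumes "continuous_on UNIV f" "compact K"
  shows "integrable (lebesgue_on K) f"
proof -
  have K: "K \<in> sets borel"
    using assms(2) by (simp add: compact_imp_closed)
  have "integrable lborel (\<lambda>x. indicator K x *\<^sub>R f x)"
    using assms by (intro borel_integrable_compact) (auto intro: continuous_on_subset)
  moreover have "(\<lambda>x. indicator K x *\<^sub>R f x) \<in> borel_measurable borel"
    using K borel_measurable_continuous_onI[OF assms(1)] by measurable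
  ultimately have "integrable lebesgue (\<lambda>x. indicator K x *\<^sub>R f x)"
    by (subst integrable_completion) auto
  then show ?thesis
    using K by (subst integrable_restrict_space) auto
qed

lemma test_functionD:
  assumes "test_function \<Omega> \<phi>"
  obtains K where "smooth \<phi>" "compact K" "K \<subseteq> \<Omega>" "\<And>x. x \<notin> K \<Longrightarrow> \<phi> x = 0"
proof (rule that)
  note conj = assms[unfolded test_function_def]
  show "smooth \<phi>" "compact (closure {x. \<phi> x \<noteq> 0})" "closure {x. \<phi> x \<noteq> 0} \<subseteq> \<Omega>"
    by (rule conj[THEN conjunct1] conj[THEN conjunct2, THEN conjunct1]
        conj[THEN conjunct2, THEN conjunct2])+
  show "\<phi> x = 0" if "x \<notin> closure {x. \<phi> x \<noteq> 0}" for x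
    using that closure_subset[of "{x. \<phi> x \<noteq> 0}"] by auto
qed

lemma weak_deriv_smooth:
  fixes w :: "real^'n::finite \<Rightarrow> real"
  assumes "smooth w" "\<Omega> \<in> sets lebesgue"
  shows "weak_deriv \<Omega> a w (iter_partial (rev a) w)"
  unfolding weak_deriv_def
proof (intro conjI allI impI)
  show "loc_integrable \<Omega> w" "loc_integrable \<Omega> (iter_partial (rev a) w)"
    using assms unfolding loc_integrable_def
    by (auto intro!: integrable_lebesgue_on_compact smooth_continuous smooth_iter_partial)
next
  fix \<phi> assume "test_function \<Omega> \<phi>"
  then obtain K where K: "smooth \<phi>" "compact K" "K \<subseteq> \<Omega>" "\<And>x. x \<notin> K \<Longrightarrow> \<phi> x = 0"
    using test_functionD by blast
  have "iter_partial a \<phi> x = 0" if "x \<notin> \<Omega>" for x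
    using that K by (intro iter_partial_eq_0_outside[of K]) (auto intro: compact_imp_closed)
  then have "(LINT x|lebesgue_on \<Omega>. w x * iter_partial a \<phi> x)
      = (LINT x|lborel. w x * iter_partial a \<phi> x)"
    using assms K
    by (intro integral_lebesgue_on_compact_support continuous_intros smooth_continuous smooth_iter_partial) auto
  moreover have "(LINT x|lebesgue_on \<Omega>. iter_partial (rev a) w x * \<phi> x)
      = (LINT x|lborel. iter_partial (rev a) w x * \<phi> x)"
    using assms K
    by (intro integral_lebesgue_on_compact_support continuous_intros smooth_continuous smooth_iter_partial) auto
  ultimately show "(LINT x|lebesgue_on \<Omega>. w x * iter_partial a \<phi> x)
      = (- 1) ^ length a * (LINT x|lebesgue_on \<Omega>. iter_partial (rev a) w x * \<phi> x)"
    using iterated_integration_by_parts[OF assms(1) K(1,2,4)] by simp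
qed

section \<open>Integrable sums of weak derivatives\<close>

text \<open>By Tonelli the sum converges absolutely almost everywhere, so that dominated convergence
  applies; on the exceptional null set the value of the sum is immaterial.\<close>

lemma integral_suminf_times_bounded:
  fixes f :: "nat \<Rightarrow> 'a \<Rightarrow> real"
  assumes int: "\<And>m. integrable M (f m)"
    and sum: "summable (\<lambda>m. LINT x|M. \<bar>f m x\<bar>)"
    and \<psi>: "\<psi> \<in> borel_measurable M" "\<And>x. \<bar>\<psi> x\<bar> \<le> B"
  shows "integrable M (\<lambda>x. \<Sum>m. f m x)"
    and "(\<lambda>m. LINT x|M. f m x * \<psi> x) sums (LINT x|M. (\<Sum>m. f m x) * \<psi> x)"
proof -
  have B: "0 \<le> B" using order_trans[OF abs_ge_zero \<psi>(2)] .
  have [measurable]: "f m \<in> borel_measurable M" for m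
    using int by auto
  note \<psi>(1) [measurable]
  have "(\<integral>\<^sup>+x. (\<Sum>m. ennreal \<bar>f m x\<bar>) \<partial>M) = (\<Sum>m. \<integral>\<^sup>+x. ennreal \<bar>f m x\<bar> \<partial>M)"
    by (rule nn_integral_suminf) simp
  also have "\<dots> = (\<Sum>m. ennreal (LINT x|M. \<bar>f m x\<bar>))"
    using int by (intro suminf_cong nn_integral_eq_integral) auto
  also have "\<dots> = ennreal (\<Sum>m. LINT x|M. \<bar>f m x\<bar>)"
    using sum by (intro suminf_ennreal2) auto
  finally have "(\<integral>\<^sup>+x. (\<Sum>m. ennreal \<bar>f m x\<bar>) \<partial>M) \<noteq> \<infinity>"
    by simp
  then have "AE x in M. (\<Sum>m. ennreal \<bar>f m x\<bar>) \<noteq> \<infinity>"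
    by (intro nn_integral_PInf_AE) auto
  then have AE: "AE x in M. summable (\<lambda>m. \<bar>f m x\<bar>)"
    by eventually_elim (auto intro: summable_suminf_not_top)
  from AE sum int show "integrable M (\<lambda>x. \<Sum>m. f m x)"
    by (intro integrable_suminf) auto
  have bound: "\<bar>f m x * \<psi> x\<bar> \<le> B * \<bar>f m x\<bar>" for m x
    using mult_right_mono[OF \<psi>(2)[of x], of "\<bar>f m x\<bar>"] by (simp add: abs_mult mult.commute)
  have int': "integrable M (\<lambda>x. f m x * \<psi> x)" for m
    by (rule Bochner_Integration.integrable_bound[of M "\<lambda>x. B * \<bar>f m x\<bar>"])
       (use int bound B in \<open>auto simp: abs_mult\<close>)
  have AE': "AE x in M. summable (\<lambda>m. \<bar>f m x * \<psi> x\<bar>)"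
    using AE
  proof eventually_elim
    case (elim x)
    show ?case
      by (rule summable_comparison_test'[OF summable_mult[OF elim, of B], of 0]) (use bound in auto)
  qed
  have sum': "summable (\<lambda>m. LINT x|M. \<bar>f m x * \<psi> x\<bar>)"
  proof (rule summable_comparison_test'[OF summable_mult[OF sum, of B], of 0])
    fix m
    have "(LINT x|M. \<bar>f m x * \<psi> x\<bar>) \<le> (LINT x|M. B * \<bar>f m x\<bar>)"
      using int int' bound by (intro integral_mono) auto
    then show "norm (LINT x|M. \<bar>f m x * \<psi> x\<bar>) \<le> B * (LINT x|M. \<bar>f m x\<bar>)"
      by simp
  qed
  have "(\<lambda>m. LINT x|M. f m x * \<psi> x) sums (LINT x|M. (\<Sum>m. f m x * \<psi> x))"
    using int' AE' sum' by (intro sums_integral) auto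
  also have "(LINT x|M. (\<Sum>m. f m x * \<psi> x)) = (LINT x|M. (\<Sum>m. f m x) * \<psi> x)"
  proof (rule integral_cong_AE)
    show "AE x in M. (\<Sum>m. f m x * \<psi> x) = (\<Sum>m. f m x) * \<psi> x"
      using AE by eventually_elim (auto intro: suminf_mult2[symmetric] summable_rabs_cancel)
  qed measurable
  finally show "(\<lambda>m. LINT x|M. f m x * \<psi> x) sums (LINT x|M. (\<Sum>m. f m x) * \<psi> x)" .
qed

lemma smooth_compact_support_bounded:
  fixes \<phi> :: "real^'n::finite \<Rightarrow> real"
  assumes "smooth \<phi>" "compact K" "\<And>x. x \<notin> K \<Longrightarrow> \<phi> x = 0"
  obtains B where "\<And>x. \<bar>iter_partial a \<phi> x\<bar> \<le> B"
proof -
  have "bounded (iter_partial a \<phi> ` K)"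
    using assms by (intro compact_imp_bounded compact_continuous_image smooth_continuous smooth_iter_partial)
  then obtain B where B: "\<And>x. x \<in> K \<Longrightarrow> \<bar>iter_partial a \<phi> x\<bar> \<le> B" "0 < B"
    by (auto simp: bounded_pos)
  have "\<bar>iter_partial a \<phi> x\<bar> \<le> B" for x
    using B iter_partial_eq_0_outside[of K \<phi> x a] assms compact_imp_closed[OF assms(2)]
    by (cases "x \<in> K") auto
  then show ?thesis by (rule that)
qed

lemma continuous_borel_measurable_lebesgue_on:
  fixes f :: "'a::euclidean_space \<Rightarrow> real"
  assumes "continuous_on UNIV f"
  shows "f \<in> borel_measurable (lebesgue_on \<Omega>)"
  by (intro measurable_restrict_space1 measurable_completion)
     (use borel_measurable_continuous_onI[OF assms] in simp)

lemma integrable_lebesgue_on_subset: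
  fixes f :: "'a::euclidean_space \<Rightarrow> real"
  assumes "integrable (lebesgue_on T) f" "S \<subseteq> T" "S \<in> sets lebesgue" "T \<in> sets lebesgue"
  shows "integrable (lebesgue_on S) f"
proof -
  have "integrable lebesgue (\<lambda>x. indicator T x *\<^sub>R f x)"
    using assms by (subst (asm) integrable_restrict_space) auto
  then have "integrable lebesgue (\<lambda>x. indicator S x *\<^sub>R (indicator T x *\<^sub>R f x))"
    by (rule integrable_mult_indicator[OF assms(3)])
  also have "(\<lambda>x. indicator S x *\<^sub>R (indicator T x *\<^sub>R f x)) = (\<lambda>x. indicator S x *\<^sub>R f x)"
    using assms(2) by (auto simp: indicator_def fun_eq_iff)
  finally show ?thesis
    using assms(3) by (subst integrable_restrict_space) auto
qed

lemma integrable_imp_loc_integrable: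
  fixes f :: "real^'n::finite \<Rightarrow> real"
  assumes "integrable (lebesgue_on \<Omega>) f" "\<Omega> \<in> sets lebesgue"
  shows "loc_integrable \<Omega> f"
  using assms integrable_lebesgue_on_subset unfolding loc_integrable_def
  by (metis borel_compact sets_completionI_sets sets_lborel)

lemma weak_deriv_suminf:
  fixes f g :: "nat \<Rightarrow> real^'n::finite \<Rightarrow> real"
  assumes \<Omega>: "\<Omega> \<in> sets lebesgue"
    and wd: "\<And>m. weak_deriv \<Omega> a (f m) (g m)"
    and f: "\<And>m. integrable (lebesgue_on \<Omega>) (f m)" "summable (\<lambda>m. LINT x|lebesgue_on \<Omega>. \<bar>f m x\<bar>)"
    and g: "\<And>m. integrable (lebesgue_on \<Omega>) (g m)" "summable (\<lambda>m. LINT x|lebesgue_on \<Omega>. \<bar>g m x\<bar>)"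
  shows "weak_deriv \<Omega> a (\<lambda>x. \<Sum>m. f m x) (\<lambda>x. \<Sum>m. g m x)"
  unfolding weak_deriv_def
proof (intro conjI allI impI)
  have "(\<lambda>x. 0) \<in> borel_measurable (lebesgue_on \<Omega>)" by simp
  from integral_suminf_times_bounded(1)[OF f this, of 0] integral_suminf_times_bounded(1)[OF g this, of 0]
  show "loc_integrable \<Omega> (\<lambda>x. \<Sum>m. f m x)" "loc_integrable \<Omega> (\<lambda>x. \<Sum>m. g m x)"
    using \<Omega> by (auto intro: integrable_imp_loc_integrable)
next
  fix \<phi> assume \<phi>: "test_function \<Omega> \<phi>"
  then obtain K where K: "smooth \<phi>" "compact K" "K \<subseteq> \<Omega>" "\<And>x. x \<notin> K \<Longrightarrow> \<phi> x = 0"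
    using test_functionD by blast
  obtain B where B: "\<And>x. \<bar>iter_partial a \<phi> x\<bar> \<le> B"
    using smooth_compact_support_bounded[OF K(1,2,4)] by blast
  obtain B' where B': "\<And>x. \<bar>iter_partial [] \<phi> x\<bar> \<le> B'"
    using smooth_compact_support_bounded[OF K(1,2,4)] by blast
  have "(\<lambda>m. LINT x|lebesgue_on \<Omega>. f m x * iter_partial a \<phi> x) sums
      (LINT x|lebesgue_on \<Omega>. (\<Sum>m. f m x) * iter_partial a \<phi> x)"
    by (rule integral_suminf_times_bounded(2)[OF f _ B])
       (intro continuous_borel_measurable_lebesgue_on smooth_continuous smooth_iter_partial K)
  moreover have "(\<lambda>m. LINT x|lebesgue_on \<Omega>. g m x * \<phi> x) sums
      (LINT x|lebesgue_on \<Omega>. (\<Sum>m. g m x) * \<phi> x)"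
    by (rule integral_suminf_times_bounded(2)[OF g _ B'[unfolded iter_partial_Nil]])
       (intro continuous_borel_measurable_lebesgue_on smooth_continuous K)
  then have "(\<lambda>m. (- 1) ^ length a * (LINT x|lebesgue_on \<Omega>. g m x * \<phi> x)) sums
      ((- 1) ^ length a * (LINT x|lebesgue_on \<Omega>. (\<Sum>m. g m x) * \<phi> x))"
    by (rule sums_mult)
  moreover have "(LINT x|lebesgue_on \<Omega>. f m x * iter_partial a \<phi> x)
      = (- 1) ^ length a * (LINT x|lebesgue_on \<Omega>. g m x * \<phi> x)" for m
    using wd[of m] \<phi> unfolding weak_deriv_def by blast
  ultimately show "(LINT x|lebesgue_on \<Omega>. (\<Sum>m. f m x) * iter_partial a \<phi> x)
      = (- 1) ^ length a * (LINT x|lebesgue_on \<Omega>. (\<Sum>m. g m x) * \<phi> x)"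
    using sums_unique2 by simp
qed

section \<open>Products of functions of one variable\<close>

definition other :: "2 \<Rightarrow> 2" where
  "other d = (if d = 1 then 2 else 1)"

lemma other_neq [simp]: "other d \<noteq> d" "d \<noteq> other d"
  and other_cases: "i = d \<or> i = other d"
  using exhaust_2[of d] exhaust_2[of i] by (auto simp: other_def)

lemma all_2_other: "(\<forall>j. P j) \<longleftrightarrow> P d \<and> P (other d)"
proof (intro iffI allI)
  fix j assume "P d \<and> P (other d)"
  then show "P j" using other_cases[of j d] by (elim disjE) simp_all
qed simp

lemma sum_2_other: "(\<Sum>i\<in>UNIV. f i) = f d + f (other d)"
proof -
  have UNIV_eq: "UNIV = {d, other d}" using other_cases[of _ d] by blast
  show ?thesis unfolding UNIV_eq by simp
qed

definition sep :: "2 \<Rightarrow> (real \<Rightarrow> real) \<Rightarrow> (real \<Rightarrow> real) \<Rightarrow> real^2 \<Rightarrow> real" where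
  "sep d f g x = f (x $ d) * g (x $ other d)"

lemma sep_has_derivative:
  assumes "(f has_real_derivative f') (at (x $ d))"
    and "(g has_real_derivative g') (at (x $ other d))"
  shows "(sep d f g has_derivative
    (\<lambda>h. f (x $ d) * (g' * h $ other d) + (f' * h $ d) * g (x $ other d))) (at x)"
proof -
  have coord: "((\<lambda>x. x $ i) has_derivative (\<lambda>h. h $ i)) (at x)" for i
    by (intro bounded_linear_imp_has_derivative bounded_linear_vec_nth)
  have "((\<lambda>x. f (x $ d)) has_derivative (\<lambda>h. f' * h $ d)) (at x)"
    by (rule has_derivative_compose[OF coord assms(1)[unfolded has_field_derivative_def]])
  moreover have "((\<lambda>x. g (x $ other d)) has_derivative (\<lambda>h. g' * h $ other d)) (at x)"
    by (rule has_derivative_compose[OF coord assms(2)[unfolded has_field_derivative_def]])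
  ultimately show ?thesis
    unfolding sep_def[abs_def] by (rule has_derivative_mult)
qed

lemma partial_deriv_sep:
  assumes "\<And>x. (f has_real_derivative f' x) (at x)" "\<And>x. (g has_real_derivative g' x) (at x)"
  shows "partial_deriv d (sep d f g) = sep d f' g"
    and "partial_deriv (other d) (sep d f g) = sep d f g'"
  by (auto simp: fun_eq_iff partial_deriv_eqI[OF sep_has_derivative[OF assms]] sep_def axis_def)

text \<open>Iterated partial derivatives of a product of this kind are again products of this kind.\<close>

lemma smooth_sep:
  assumes "smooth1 f" "smooth1 g"
  shows "smooth (sep d f g)"
proof -
  have "\<exists>f' g'. smooth1 f' \<and> smooth1 g' \<and> iter_partial a (sep d f g) = sep d f' g'" for a
  proof (induction a)
    case Nil
    with assms show ?case by auto
  next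
    case (Cons i a)
    then obtain f' g' where fg: "smooth1 f'" "smooth1 g'" "iter_partial a (sep d f g) = sep d f' g'"
      by blast
    obtain f'' where f'': "\<And>x. (f' has_real_derivative f'' x) (at x)" "smooth1 f''"
      using smooth1_obtain_deriv[OF fg(1)] by blast
    obtain g'' where g'': "\<And>x. (g' has_real_derivative g'' x) (at x)" "smooth1 g''"
      using smooth1_obtain_deriv[OF fg(2)] by blast
    consider "i = d" | "i = other d" using other_cases by blast
    then show ?case
    proof cases
      case 1
      have "iter_partial (i # a) (sep d f g) = sep d f'' g'"
        unfolding iter_partial_Cons fg(3) 1 by (rule partial_deriv_sep(1)[OF f''(1) g''(1)])
      with f''(2) fg(2) show ?thesis by blast
    next
      case 2
      have "iter_partial (i # a) (sep d f g) = sep d f' g''"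
        unfolding iter_partial_Cons fg(3) 2 by (rule partial_deriv_sep(2)[OF f''(1) g''(1)])
      with fg(1) g''(2) show ?thesis by blast
    qed
  qed
  moreover have "sep d f' g' differentiable (at x)" if sm: "smooth1 f'" "smooth1 g'" for f' g' x
  proof -
    obtain f'' where "\<And>x. (f' has_real_derivative f'' x) (at x)"
      using smooth1_obtain_deriv[OF sm(1)] by blast
    moreover obtain g'' where "\<And>x. (g' has_real_derivative g'' x) (at x)"
      using smooth1_obtain_deriv[OF sm(2)] by blast
    ultimately show ?thesis
      by (rule differentiableI[OF sep_has_derivative])
  qed
  ultimately show ?thesis
    unfolding smooth_def by metis
qed

section \<open>The building block\<close>

text \<open>The Lorentz profile. Its first two derivatives are dominated by a multiple of itself, and it is
  the second derivative of a function with bounded slope.\<close>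

definition lor :: "real \<Rightarrow> real" where
  "lor y = 1 / (1 + y\<^sup>2)"

definition lor' :: "real \<Rightarrow> real" where
  "lor' y = - 2 * y / (1 + y\<^sup>2) ^ 2"

definition lor'' :: "real \<Rightarrow> real" where
  "lor'' y = (6 * y\<^sup>2 - 2) / (1 + y\<^sup>2) ^ 3"

definition lor_prim :: "real \<Rightarrow> real" where
  "lor_prim y = y * arctan y - ln (1 + y\<^sup>2) / 2"

lemma one_plus_square [simp]: "0 < 1 + y\<^sup>2" "1 + y\<^sup>2 \<noteq> 0" for y :: real
  using zero_le_power2[of y] by linarith+

lemma lor_deriv: "(lor has_real_derivative lor' y) (at y)"
  unfolding lor_def[abs_def] lor'_def
  using one_plus_square(2)[of y, unfolded power2_eq_square]
  by (auto intro!: derivative_eq_intros simp: power2_eq_square)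

lemma lor'_deriv: "(lor' has_real_derivative lor'' y) (at y)"
proof -
  have "(lor' has_real_derivative
      (- 2 * (1 + y\<^sup>2) ^ 2 - (- 2 * y) * (2 * (1 + y\<^sup>2) * (2 * y))) / ((1 + y\<^sup>2) ^ 2 * (1 + y\<^sup>2) ^ 2)) (at y)"
    unfolding lor'_def[abs_def]
    by (rule derivative_eq_intros refl | simp)+
  also have "(- 2 * (1 + y\<^sup>2) ^ 2 - (- 2 * y) * (2 * (1 + y\<^sup>2) * (2 * y))) / ((1 + y\<^sup>2) ^ 2 * (1 + y\<^sup>2) ^ 2)
      = lor'' y"
  proof -
    define z where "z = 1 + y\<^sup>2"
    have "z \<noteq> 0" and y: "y\<^sup>2 = z - 1" unfolding z_def by auto
    have "(- 2 * z ^ 2 - (- 2 * y) * (2 * z * (2 * y))) = z * (8 * y\<^sup>2 - 2 * z)"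
      by (simp add: power2_eq_square algebra_simps)
    also have "\<dots> = z * (6 * y\<^sup>2 - 2)" by (simp add: y)
    finally show ?thesis
      using \<open>z \<noteq> 0\<close> unfolding lor''_def z_def[symmetric]
      by (simp add: power2_eq_square power3_eq_cube)
  qed
  finally show ?thesis .
qed

lemma arctan_deriv: "(arctan has_real_derivative lor y) (at y)"
  using DERIV_arctan[of y] by (simp add: lor_def inverse_eq_divide)

lemma lor_prim_deriv: "(lor_prim has_real_derivative arctan y) (at y)"
proof -
  have "((\<lambda>y. ln (1 + y\<^sup>2)) has_real_derivative 2 * y * lor y) (at y)"
    by (auto intro!: derivative_eq_intros simp: lor_def)
  from DERIV_diff[OF DERIV_mult[OF DERIV_ident arctan_deriv[of y]] DERIV_cdivide[OF this, of 2]]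
  show ?thesis
    unfolding lor_prim_def[abs_def] by (simp add: mult.commute)
qed

text \<open>The identity \<open>lor' = (- 2 * y) * lor\<^sup>2\<close> lets the order of differentiability climb by
  itself.\<close>

lemma smooth1_lor: "smooth1 lor"
  unfolding smooth1_def
proof
  fix n show "times_diff n lor"
  proof (induction n)
    case (Suc n)
    have id: "times_diff n (\<lambda>y. y)"
      using smooth1_ident unfolding smooth1_def by blast
    have "times_diff n (\<lambda>y. (- 2 * y) * (lor y * lor y))"
      by (intro times_diff_mult times_diff_const id Suc)
    moreover have "(\<lambda>y. (- 2 * y) * (lor y * lor y)) = lor'"
      by (simp add: fun_eq_iff lor_def lor'_def power2_eq_square)
    ultimately have "times_diff n lor'"
      by metis
    then show ?case
      unfolding times_diff.simps by (intro exI conjI allI) (rule lor_deriv)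
  qed simp
qed

lemma smooth1_arctan: "smooth1 arctan"
  by (rule smooth1I[OF arctan_deriv smooth1_lor])

lemma smooth1_lor_prim: "smooth1 lor_prim"
  by (rule smooth1I[OF lor_prim_deriv smooth1_arctan])

lemma lor_pos: "0 < lor y" and lor_le_1: "lor y \<le> 1"
  by (simp_all add: lor_def)

lemma abs_lor'_le: "\<bar>lor' y\<bar> \<le> lor y"
proof -
  have "\<bar>2 * y\<bar> \<le> 1 + y\<^sup>2"
    using zero_le_power2[of "y - 1"] zero_le_power2[of "y + 1"] by (auto simp: abs_le_iff power2_eq_square algebra_simps)
  moreover have "\<bar>lor' y\<bar> = \<bar>2 * y\<bar> / (1 + y\<^sup>2) * lor y"
    by (simp add: lor'_def lor_def power2_eq_square abs_mult abs_divide)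
  moreover from calculation(1) have "\<bar>2 * y\<bar> / (1 + y\<^sup>2) \<le> 1"
    by (simp add: divide_le_eq_1)
  ultimately show ?thesis
    using lor_pos[of y] mult_right_mono[of "\<bar>2 * y\<bar> / (1 + y\<^sup>2)" 1 "lor y"] by simp
qed

lemma abs_lor''_le: "\<bar>lor'' y\<bar> \<le> 6 * lor y"
proof -
  define z where "z = 1 + y\<^sup>2"
  have z: "1 \<le> z" and y: "y\<^sup>2 = z - 1" unfolding z_def by auto
  have "\<bar>6 * z - 8\<bar> \<le> 6 * z ^ 2"
  proof -
    have "z * 1 \<le> z * z" using z by (intro mult_left_mono) auto
    then have "z \<le> z ^ 2" by (simp add: power2_eq_square)
    with z show ?thesis unfolding abs_le_iff by (intro conjI; linarith)
  qed
  then have "\<bar>6 * z - 8\<bar> / z ^ 3 \<le> 6 * z ^ 2 / z ^ 3"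
    using z by (intro divide_right_mono) auto
  then show ?thesis
    using z unfolding lor''_def lor_def z_def[symmetric] y
    by (simp add: abs_divide algebra_simps power2_eq_square power3_eq_cube)
qed

lemma abs_arctan_le: "\<bar>arctan y\<bar> \<le> 2"
  using arctan_bounded[of y] pi_less_4 by auto

lemma abs_lor_prim_le: "\<bar>lor_prim y\<bar> \<le> 2 * \<bar>y\<bar>"
proof -
  have "\<bar>lor_prim y - lor_prim 0\<bar> \<le> 2 * \<bar>y - 0\<bar>"
    using field_differentiable_bound[of UNIV lor_prim arctan 2 y 0] lor_prim_deriv abs_arctan_le
    by (auto intro: has_field_derivative_at_within)
  then show ?thesis by (simp add: lor_prim_def)
qed

text \<open>The factor \<open>7\<close> is what subharmonicity costs: the ripple can lower the Laplacian by \<open>lor s / r\<close>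
  through its derivatives along the line and by \<open>6 * lor s / r\<close> through those across it.\<close>

definition block :: "2 \<Rightarrow> real \<Rightarrow> real \<Rightarrow> real^2 \<Rightarrow> real" where
  "block d t r x = sep d (\<lambda>_. 7 * r) (\<lambda>y. lor_prim ((y - t) / r)) x
     + sep d (\<lambda>y. r * cos (y / r)) (\<lambda>y. lor ((y - t) / r)) x"

lemma deriv_rescale:
  assumes "(f has_real_derivative f') (at ((y - t) / r))"
  shows "((\<lambda>y. f ((y - t) / r)) has_real_derivative f' / r) (at y)"
proof -
  have "((\<lambda>y. (y - t) / r) has_real_derivative 1 / r) (at y)"
    by (cases "r = 0") (auto intro!: derivative_eq_intros)
  from DERIV_chain2[OF assms this] show ?thesis by simp
qed

lemma smooth1_wave:
  assumes "smooth1 f" shows "smooth1 (\<lambda>y. c * f (y / r))"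
  using smooth1_mult[of "\<lambda>_. c" "\<lambda>y. f (y / r)", OF smooth1_const]
    smooth1_rescale[OF assms, of 0 r] by simp

lemma smooth_block: "smooth (block d t r)"
  unfolding block_def[abs_def]
  by (rule smooth_add[OF smooth_sep[OF smooth1_const smooth1_rescale[OF smooth1_lor_prim]]
        smooth_sep[OF smooth1_wave[OF smooth1_cos] smooth1_rescale[OF smooth1_lor]]])

lemma partial_deriv_sep_add:
  assumes "\<And>x. (f has_real_derivative f' x) (at x)" "\<And>x. (g has_real_derivative g' x) (at x)"
    and "\<And>x. (h has_real_derivative h' x) (at x)" "\<And>x. (k has_real_derivative k' x) (at x)"
  shows "partial_deriv d (\<lambda>x. sep d f g x + sep d h k x) = (\<lambda>x. sep d f' g x + sep d h' k x)"
    and "partial_deriv (other d) (\<lambda>x. sep d f g x + sep d h k x) = (\<lambda>x. sep d f g' x + sep d h k' x)"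
proof -
  have diff: "sep d f g differentiable (at x)" "sep d h k differentiable (at x)" for x
    by (rule differentiableI[OF sep_has_derivative[OF assms(1,2)]]
        differentiableI[OF sep_has_derivative[OF assms(3,4)]])+
  show "partial_deriv d (\<lambda>x. sep d f g x + sep d h k x) = (\<lambda>x. sep d f' g x + sep d h' k x)"
    "partial_deriv (other d) (\<lambda>x. sep d f g x + sep d h k x) = (\<lambda>x. sep d f g' x + sep d h k' x)"
    using partial_deriv_sep[OF assms(1,2), of d] partial_deriv_sep[OF assms(3,4), of d]
    by (simp_all add: fun_eq_iff partial_deriv_add[OF diff])
qed

lemma abs_mult_le_of_abs_le_1: "\<bar>c\<bar> \<le> 1 \<Longrightarrow> \<bar>z\<bar> \<le> m \<Longrightarrow> \<bar>c * z\<bar> \<le> m" for c z m :: real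
  unfolding abs_mult using mult_mono[of "\<bar>c\<bar>" 1 "\<bar>z\<bar>" m] by simp

context
  fixes d :: 2 and t r :: real
  assumes r: "0 < r"
begin

lemma cos_wave_deriv: "((\<lambda>y. c * cos (y / r)) has_real_derivative - (c / r) * sin (y / r)) (at y)"
  and sin_wave_deriv: "((\<lambda>y. c * sin (y / r)) has_real_derivative c / r * cos (y / r)) (at y)"
  using r by (auto intro!: derivative_eq_intros)

lemma partial_block_d:
  "partial_deriv d (block d t r) = sep d (\<lambda>y. - 1 * sin (y / r)) (\<lambda>y. lor ((y - t) / r))"
  unfolding block_def[abs_def]
  by (subst partial_deriv_sep_add(1)[OF DERIV_const deriv_rescale[OF lor_prim_deriv]
        cos_wave_deriv deriv_rescale[OF lor_deriv]]) (use r in \<open>auto simp: sep_def fun_eq_iff\<close>)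

lemma partial_block_other:
  "partial_deriv (other d) (block d t r) =
     (\<lambda>x. sep d (\<lambda>_. 7) (\<lambda>y. arctan ((y - t) / r)) x
        + sep d (\<lambda>y. 1 * cos (y / r)) (\<lambda>y. lor' ((y - t) / r)) x)"
  unfolding block_def[abs_def]
  by (subst partial_deriv_sep_add(2)[OF DERIV_const deriv_rescale[OF lor_prim_deriv]
        cos_wave_deriv deriv_rescale[OF lor_deriv]]) (use r in \<open>auto simp: sep_def fun_eq_iff\<close>)

lemma partial_block_dd:
  "partial_deriv d (partial_deriv d (block d t r)) x
     = - (cos (x $ d / r) * lor ((x $ other d - t) / r) / r)"
  unfolding partial_block_d
  by (subst partial_deriv_sep(1)[OF sin_wave_deriv deriv_rescale[OF lor_deriv]]) (simp add: sep_def)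

lemma partial_block_od:
  "partial_deriv (other d) (partial_deriv d (block d t r)) x
     = - (sin (x $ d / r) * lor' ((x $ other d - t) / r) / r)"
  unfolding partial_block_d
  by (subst partial_deriv_sep(2)[OF sin_wave_deriv deriv_rescale[OF lor_deriv]]) (simp add: sep_def)

lemma partial_block_do:
  "partial_deriv d (partial_deriv (other d) (block d t r)) x
     = - (sin (x $ d / r) * lor' ((x $ other d - t) / r) / r)"
  unfolding partial_block_other
  by (subst partial_deriv_sep_add(1)[OF DERIV_const deriv_rescale[OF arctan_deriv]
        cos_wave_deriv deriv_rescale[OF lor'_deriv]]) (simp add: sep_def)

lemma partial_block_oo:
  "partial_deriv (other d) (partial_deriv (other d) (block d t r)) x
     = (7 * lor ((x $ other d - t) / r) + cos (x $ d / r) * lor'' ((x $ other d - t) / r)) / r"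
  unfolding partial_block_other
  by (subst partial_deriv_sep_add(2)[OF DERIV_const deriv_rescale[OF arctan_deriv]
        cos_wave_deriv deriv_rescale[OF lor'_deriv]]) (simp add: sep_def add_divide_distrib)

lemma abs_partial_block_le: "\<bar>partial_deriv i (block d t r) x\<bar> \<le> 15"
proof -
  let ?s = "(x $ other d - t) / r" and ?\<theta> = "x $ d / r"
  have l: "0 < lor ?s" "lor ?s \<le> 1" "\<bar>lor' ?s\<bar> \<le> lor ?s" "\<bar>arctan ?s\<bar> \<le> 2"
    using lor_pos lor_le_1 abs_lor'_le abs_arctan_le by auto
  then have "\<bar>sin ?\<theta> * lor ?s\<bar> \<le> 1" "\<bar>cos ?\<theta> * lor' ?s\<bar> \<le> 1"
    by (intro abs_mult_le_of_abs_le_1; simp)+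
  with l other_cases[of i d] show ?thesis
    by (auto simp: partial_block_d partial_block_other sep_def)
qed

lemma abs_partial2_block_le:
  "\<bar>partial_deriv i (partial_deriv j (block d t r)) x\<bar> \<le> 13 * (lor ((x $ other d - t) / r) / r)"
proof -
  let ?s = "(x $ other d - t) / r" and ?\<theta> = "x $ d / r"
  define D where "D = r * partial_deriv i (partial_deriv j (block d t r)) x"
  have l: "0 < lor ?s" "\<bar>lor' ?s\<bar> \<le> lor ?s" "\<bar>lor'' ?s\<bar> \<le> 6 * lor ?s"
    using lor_pos abs_lor'_le abs_lor''_le by auto
  then have b: "\<bar>cos ?\<theta> * lor ?s\<bar> \<le> lor ?s" "\<bar>sin ?\<theta> * lor' ?s\<bar> \<le> lor ?s"
    "\<bar>cos ?\<theta> * lor'' ?s\<bar> \<le> 6 * lor ?s"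
    by (intro abs_mult_le_of_abs_le_1; simp)+
  have "\<bar>D\<bar> \<le> 13 * lor ?s"
    using l(1) b r other_cases[of i d] other_cases[of j d] unfolding D_def
    by (elim disjE) (simp_all add: partial_block_dd partial_block_od partial_block_do partial_block_oo)
  moreover have "\<bar>D\<bar> = r * \<bar>partial_deriv i (partial_deriv j (block d t r)) x\<bar>"
    using r by (simp add: D_def abs_mult)
  ultimately show ?thesis
    using r by (simp add: field_simps)
qed

lemma laplacian_block_nonneg: "0 \<le> (\<Sum>i\<in>UNIV. partial_deriv i (partial_deriv i (block d t r)) x)"
proof -
  let ?s = "(x $ other d - t) / r" and ?\<theta> = "x $ d / r"
  have l: "0 < lor ?s" "\<bar>lor'' ?s\<bar> \<le> 6 * lor ?s"
    using lor_pos abs_lor''_le by auto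
  then have "\<bar>cos ?\<theta> * lor ?s\<bar> \<le> lor ?s" "\<bar>cos ?\<theta> * lor'' ?s\<bar> \<le> 6 * lor ?s"
    by (intro abs_mult_le_of_abs_le_1; simp)+
  then have "0 \<le> (7 * lor ?s + cos ?\<theta> * lor'' ?s - cos ?\<theta> * lor ?s) / r"
    using r by (intro divide_nonneg_pos) linarith+
  then show ?thesis
    by (simp add: sum_2_other[of _ d] partial_block_dd partial_block_oo diff_divide_distrib)
qed

lemma abs_block_le:
  assumes "x \<in> ball 0 1" "\<bar>t\<bar> \<le> 1" "r \<le> 1"
  shows "\<bar>block d t r x\<bar> \<le> 29"
proof -
  let ?s = "(x $ other d - t) / r"
  have "\<bar>7 * r * lor_prim ?s\<bar> = 7 * (r * \<bar>lor_prim ?s\<bar>)"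
    using r by (simp add: abs_mult)
  also have "\<dots> \<le> 7 * (r * (2 * \<bar>?s\<bar>))"
    using r by (intro mult_left_mono abs_lor_prim_le) auto
  also have "\<dots> = 14 * \<bar>x $ other d - t\<bar>"
    using r by (simp add: abs_divide)
  also have "\<dots> \<le> 28"
    using assms component_le_norm_cart[of x "other d"] by (simp add: dist_norm)
  finally have 1: "\<bar>7 * r * lor_prim ?s\<bar> \<le> 28" .
  have "\<bar>lor ?s\<bar> \<le> 1"
    using lor_pos[of ?s] lor_le_1[of ?s] by simp
  then have "\<bar>cos (x $ d / r) * lor ?s\<bar> \<le> 1"
    by (intro abs_mult_le_of_abs_le_1) auto
  then have "\<bar>r * (cos (x $ d / r) * lor ?s)\<bar> \<le> 1"
    by (rule abs_mult_le_of_abs_le_1[rotated]) (use r assms in simp)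
  with 1 show ?thesis
    unfolding block_def sep_def by (simp add: mult.assoc)
qed

lemma lipschitz_block: "30-lipschitz_on S (block d t r)"
proof -
  let ?f = "block d t r"
  have diff: "(?f has_derivative frechet_derivative ?f (at x)) (at x)" for x
    by (intro differentiable_has_derivative smooth_differentiable smooth_block)
  have "norm (frechet_derivative ?f (at x) h) \<le> 30 * norm h" for x h
  proof -
    have lin: "linear (frechet_derivative ?f (at x))"
      using diff has_derivative_linear by blast
    have "frechet_derivative ?f (at x) h = frechet_derivative ?f (at x) (\<Sum>i\<in>UNIV. (h $ i) *\<^sub>R axis i 1)"
      by (simp add: basis_expansion flip: scalar_mult_eq_scaleR)
    also have "\<dots> = (\<Sum>i\<in>UNIV. h $ i * partial_deriv i ?f x)"
      by (simp add: linear_sum[OF lin] linear_cmul[OF lin] partial_deriv_def)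
    finally have "norm (frechet_derivative ?f (at x) h) \<le> (\<Sum>i\<in>UNIV. \<bar>h $ i\<bar> * \<bar>partial_deriv i ?f x\<bar>)"
      by (simp add: sum_abs[THEN order_trans] abs_mult[symmetric])
    also have "\<dots> \<le> (\<Sum>i\<in>(UNIV::2 set). norm h * 15)"
      by (intro sum_mono mult_mono component_le_norm_cart abs_partial_block_le) auto
    finally show ?thesis by simp
  qed
  then have "30-lipschitz_on UNIV ?f"
    by (intro bounded_derivative_imp_lipschitz[OF has_derivative_at_withinI[OF diff]] onorm_bound) auto
  then show ?thesis
    by (rule lipschitz_on_subset) simp
qed

end

text \<open>The integrand is the derivative of the bounded function \<open>arctan s\<close>. After insertion of a
  cutoff \<open>\<zeta>\<close>, integration by parts puts the derivative on \<open>\<zeta>\<close>, which is the same for all widths and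
  positions.\<close>

lemma integral_lor_bounded:
  obtains C where "0 \<le> C"
    "\<And>d t r. 0 < r \<Longrightarrow> (LINT x|lebesgue_on (ball (0::real^2) 1). lor ((x $ other d - t) / r) / r) \<le> C"
proof -
  define \<zeta> where "\<zeta> = (\<lambda>d. sep d (\<lambda>y. bump (y / 2)) (\<lambda>y. bump (y / 2)))"
  define K where "K = (cbox (\<chi> i. - 2) (\<chi> i. 2) :: (real^2) set)"
  define C where "C = exp 8 * (2 * (\<Sum>d\<in>UNIV. LINT x|lborel. \<bar>partial_deriv (other d) (\<zeta> d) x\<bar>))"
  have "0 \<le> C"
    unfolding C_def by (intro mult_nonneg_nonneg sum_nonneg) auto
  moreover have "(LINT x|lebesgue_on (ball (0::real^2) 1). lor ((x $ other d - t) / r) / r) \<le> C"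
    if r: "0 < r" for d t r
  proof -
    let ?l = "\<lambda>x::real^2. lor ((x $ other d - t) / r) / r"
    define v where "v = sep d (\<lambda>_. 1) (\<lambda>y. arctan ((y - t) / r))"
    have sm: "smooth v" "smooth (\<zeta> d)"
      unfolding v_def \<zeta>_def
      using smooth1_rescale[OF smooth1_arctan] smooth1_rescale[OF smooth1_bump, of 0 2]
      by (auto intro!: smooth_sep)
    have K: "compact K" "\<And>x. x \<notin> K \<Longrightarrow> \<zeta> d x = 0"
    proof -
      show "compact K" by (simp add: K_def)
      fix x assume "x \<notin> K"
      then obtain i where "\<not> (- 2 \<le> x $ i \<and> x $ i \<le> 2)"
        unfolding K_def mem_box_cart by auto
      then have "1 \<le> \<bar>x $ i / 2\<bar>" by auto
      then have "bump (x $ i / 2) = 0" by (rule bump_eq_0)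
      with other_cases[of i d] show "\<zeta> d x = 0" by (auto simp: \<zeta>_def sep_def)
    qed
    let ?D = "partial_deriv (other d) (\<zeta> d)"
    have Dv: "partial_deriv (other d) v = ?l"
      unfolding v_def
      by (subst partial_deriv_sep(2)[OF DERIV_const deriv_rescale[OF arctan_deriv]])
         (simp add: sep_def[abs_def])
    have smD: "smooth ?D" "smooth ?l"
      using smooth_partial_deriv sm Dv by metis+
    have D0: "?D x = 0" if "x \<notin> K" for x
      by (rule partial_deriv_eq_0_outside[OF _ K(2) that]) (use K(1) compact_imp_closed in auto)
    have int: "integrable lborel (\<lambda>x. ?l x * \<zeta> d x)" "integrable lborel (\<lambda>x. v x * ?D x)"
      "integrable lborel (\<lambda>x. 2 * \<bar>?D x\<bar>)"
      by (rule integrable_compact_support[OF _ K(1)],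
          intro continuous_intros smooth_continuous sm smD, simp add: K(2) D0)+
    have \<zeta>_ge: "exp (- 8) \<le> \<zeta> d x" if "x \<in> ball 0 1" for x
    proof -
      have "exp (- 4) \<le> bump (x $ i / 2)" for i
        using that component_le_norm_cart[of x i] by (intro bump_ge) (simp add: dist_norm)
      then have "exp (- 4) * exp (- 4) \<le> \<zeta> d x"
        unfolding \<zeta>_def sep_def using bump_nonneg by (intro mult_mono) auto
      then show ?thesis by (simp flip: exp_add)
    qed
    have \<zeta>_nonneg: "0 \<le> \<zeta> d x" for x
      by (simp add: \<zeta>_def sep_def bump_nonneg)
    have l_nonneg: "0 \<le> ?l x" for x
      using r lor_pos[of "(x $ other d - t) / r"] by simp
    have "(LINT x|lebesgue_on (ball 0 1). ?l x) = (LINT x|lebesgue. indicator (ball 0 1) x *\<^sub>R ?l x)"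
      by (intro integral_restrict_space) auto
    also have "\<dots> = (LINT x|lborel. indicator (ball 0 1) x *\<^sub>R ?l x)"
    proof (rule integral_completion)
      have "?l \<in> borel_measurable lborel"
        using borel_measurable_continuous_onI[OF smooth_continuous[OF smD(2)]] by simp
      then show "(\<lambda>x. indicator (ball 0 1) x *\<^sub>R ?l x) \<in> borel_measurable lborel"
        by (intro borel_measurable_scaleR borel_measurable_indicator) auto
    qed
    also have "\<dots> \<le> (LINT x|lborel. exp 8 * (?l x * \<zeta> d x))"
    proof (rule integral_mono')
      fix x :: "real^2"
      show nonneg: "0 \<le> exp 8 * (?l x * \<zeta> d x)"
        by (intro mult_nonneg_nonneg \<zeta>_nonneg l_nonneg) simp
      show "indicator (ball 0 1) x *\<^sub>R ?l x \<le> exp 8 * (?l x * \<zeta> d x)"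
      proof (cases "x \<in> ball 0 1")
        case True
        have "?l x * 1 = exp 8 * (?l x * exp (- 8))"
          by (simp flip: exp_add)
        also have "\<dots> \<le> exp 8 * (?l x * \<zeta> d x)"
          using \<zeta>_ge[OF True] l_nonneg[of x] by (intro mult_left_mono) auto
        finally show ?thesis using True by simp
      qed (use nonneg in simp)
    qed (intro integrable_mult_right int)
    also have "\<dots> = exp 8 * - (LINT x|lborel. v x * ?D x)"
      using integration_by_parts[OF sm K, of "other d"] by (simp add: Dv)
    also have "\<dots> \<le> exp 8 * (LINT x|lborel. 2 * \<bar>?D x\<bar>)"
    proof (intro mult_left_mono)
      have "- (LINT x|lborel. v x * ?D x) = (LINT x|lborel. - (v x * ?D x))"
        by simp
      also have "\<dots> \<le> (LINT x|lborel. 2 * \<bar>?D x\<bar>)"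
      proof (rule integral_mono)
        fix x :: "real^2"
        have "\<bar>v x\<bar> \<le> 2"
          by (simp add: v_def sep_def abs_arctan_le)
        then have "\<bar>v x * ?D x\<bar> \<le> 2 * \<bar>?D x\<bar>"
          unfolding abs_mult by (intro mult_right_mono) auto
        then show "- (v x * ?D x) \<le> 2 * \<bar>?D x\<bar>" by linarith
      qed (use int in auto)
      finally show "- (LINT x|lborel. v x * ?D x) \<le> (LINT x|lborel. 2 * \<bar>?D x\<bar>)" .
    qed simp
    also have "\<dots> \<le> C"
      unfolding C_def
      by (simp, rule member_le_sum[of d UNIV "\<lambda>d. LINT x|lborel. \<bar>partial_deriv (other d) (\<zeta> d) x\<bar>"]) auto
    finally show ?thesis .
  qed
  ultimately show ?thesis using that by blast
qed

lemma integrable_on_ball: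
  fixes f :: "'a::euclidean_space \<Rightarrow> real"
  assumes "continuous_on UNIV f"
  shows "integrable (lebesgue_on (ball x e)) f"
  by (rule integrable_lebesgue_on_subset[OF integrable_lebesgue_on_compact[OF assms compact_cball[of x e]]])
     auto

lemma integral_block_bounded:
  obtains C where "0 \<le> C"
    "\<And>d t r a. 0 < r \<Longrightarrow> r \<le> 1 \<Longrightarrow> \<bar>t\<bar> \<le> 1 \<Longrightarrow> length a \<le> 2 \<Longrightarrow>
       (LINT x|lebesgue_on (ball 0 1). \<bar>iter_partial a (block d t r) x\<bar>) \<le> C"
proof -
  let ?M = "lebesgue_on (ball (0 :: real^2) 1)"
  obtain C where C: "0 \<le> C"
    "\<And>d t r. 0 < r \<Longrightarrow> (LINT x|?M. lor ((x $ other d - t) / r) / r) \<le> C"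
    using integral_lor_bounded by blast
  interpret finite_measure ?M
    by (intro finite_measure_lebesgue_on lmeasurable_ball)
  define C' where "C' = 29 * measure ?M (space ?M) + 13 * C"
  have "(LINT x|?M. \<bar>iter_partial a (block d t r) x\<bar>) \<le> C'"
    if r: "0 < r" "r \<le> 1" and t: "\<bar>t\<bar> \<le> 1" and a: "length a \<le> 2" for d t r and a :: "2 list"
  proof -
    have le29: ?thesis if "\<And>x. x \<in> ball 0 1 \<Longrightarrow> \<bar>iter_partial a (block d t r) x\<bar> \<le> 29"
    proof -
      have "(LINT x|?M. \<bar>iter_partial a (block d t r) x\<bar>) \<le> (LINT x|?M. 29)"
        using that by (intro integral_mono' integrable_const) auto
      also have "\<dots> \<le> C'"
        using C(1) by (simp add: C'_def)
      finally show ?thesis .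
    qed
    consider "a = []" | i where "a = [i]" | i j where "a = [i, j]"
      using a by (auto simp: le_Suc_eq length_Suc_conv numeral_2_eq_2)
    then show ?thesis
    proof cases
      case 1
      then show ?thesis
        using abs_block_le[OF r(1) _ t r(2)] by (intro le29) simp
    next
      case 2
      then show ?thesis
        using order_trans[OF abs_partial_block_le[OF r(1), of i d t], of 29]
        by (intro le29) (simp add: iter_partial_Cons)
    next
      case 3
      let ?l = "\<lambda>x :: real^2. lor ((x $ other d - t) / r) / r"
      have sm: "smooth (sep d (\<lambda>_. 1 / r) (\<lambda>y. lor ((y - t) / r)))"
        by (rule smooth_sep[OF smooth1_const smooth1_rescale[OF smooth1_lor]])
      have "?l = sep d (\<lambda>_. 1 / r) (\<lambda>y. lor ((y - t) / r))"
        by (simp add: sep_def fun_eq_iff)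
      then have int: "integrable ?M ?l"
        using integrable_on_ball[OF smooth_continuous[OF sm]] by simp
      have "(LINT x|?M. \<bar>iter_partial a (block d t r) x\<bar>) \<le> (LINT x|?M. 13 * ?l x)"
      proof (rule integral_mono')
        show "\<bar>iter_partial a (block d t r) x\<bar> \<le> 13 * ?l x" for x
          using abs_partial2_block_le[OF r(1)] 3 by (simp add: iter_partial_Cons)
        then show "0 \<le> 13 * ?l x" for x
          using order_trans[OF abs_ge_zero] by blast
      qed (intro integrable_mult_right int)
      also have "\<dots> = 13 * (LINT x|?M. ?l x)"
        by (rule integral_mult_right_zero)
      also have "\<dots> \<le> C'"
        unfolding C'_def
        using mult_left_mono[OF C(2)[OF r(1), of d t], of 13] measure_nonneg[of ?M "space ?M"]
        by linarith
      finally show ?thesis .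
    qed
  qed
  moreover have "0 \<le> C'"
    using C(1) by (simp add: C'_def)
  ultimately show ?thesis using that by blast
qed

section \<open>Probing the oscillation of a block\<close>

definition strip :: "2 \<Rightarrow> real \<Rightarrow> real \<Rightarrow> real \<Rightarrow> real \<Rightarrow> (real^2) set" where
  "strip i z \<epsilon> t r = {x. \<bar>x $ i - z\<bar> \<le> \<epsilon> \<and> \<bar>x $ other i - t\<bar> \<le> r}"

lemma strip_eq_cbox:
  "strip i z \<epsilon> t r = cbox (\<chi> j. if j = i then z - \<epsilon> else t - r) (\<chi> j. if j = i then z + \<epsilon> else t + r)"
  unfolding strip_def by (auto simp: mem_box_cart all_2_other[of _ i] abs_le_iff)

lemma compact_strip: "compact (strip i z \<epsilon> t r)"
  by (simp add: strip_eq_cbox)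

lemma measure_strip:
  assumes "0 \<le> \<epsilon>" "0 \<le> r"
  shows "measure lborel (strip i z \<epsilon> t r) = 4 * \<epsilon> * r"
proof -
  have UNIV_eq: "UNIV = {i, other i}" using other_cases[of _ i] by blast
  have "(\<chi> j. if j = i then z else t) \<in> strip i z \<epsilon> t r"
    using assms by (simp add: strip_def)
  then have "strip i z \<epsilon> t r \<noteq> {}" by blast
  then show ?thesis
    unfolding strip_eq_cbox by (subst content_cbox_cart) (simp_all add: UNIV_eq)
qed

lemma integral_indicator_strip:
  assumes "0 \<le> \<epsilon>" "0 \<le> r"
  shows "(LINT x|lborel. indicator (strip i z \<epsilon> t r) x) = 4 * \<epsilon> * r"
    and "integrable lborel (indicator (strip i z \<epsilon> t r) :: real^2 \<Rightarrow> real)"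
proof -
  have fin: "strip i z \<epsilon> t r \<in> sets lborel" "emeasure lborel (strip i z \<epsilon> t r) < \<infinity>"
    using compact_strip[of i z \<epsilon> t r] emeasure_bounded_finite[OF compact_imp_bounded]
    by (auto simp: compact_imp_closed)
  then show "integrable lborel (indicator (strip i z \<epsilon> t r) :: real^2 \<Rightarrow> real)"
    by (intro integrable_real_indicator)
  show "(LINT x|lborel. indicator (strip i z \<epsilon> t r) x) = 4 * \<epsilon> * r"
    using fin measure_strip[OF assms] by simp
qed

text \<open>The weight \<open>1 + cos (y / r)\<close> is nonnegative and resonates with the ripple of a block of the
  same width: the mean of \<open>cos \<theta> * (1 + cos \<theta>)\<close> over a period is \<open>1 / 2\<close>.\<close>

definition probe :: "2 \<Rightarrow> real \<Rightarrow> real \<Rightarrow> real \<Rightarrow> real \<Rightarrow> real^2 \<Rightarrow> real" where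
  "probe i z \<epsilon> t r =
     sep i (\<lambda>y. (1 + 1 * cos (y / r)) * bump ((y - z) / \<epsilon>)) (\<lambda>y. bump ((y - t) / r))"

lemma smooth_probe: "smooth (probe i z \<epsilon> t r)"
  unfolding probe_def
  by (rule smooth_sep[OF smooth1_mult[OF smooth1_add[OF smooth1_const smooth1_wave[OF smooth1_cos]]
        smooth1_rescale[OF smooth1_bump]] smooth1_rescale[OF smooth1_bump]])

lemma probe_nonneg: "0 \<le> probe i z \<epsilon> t r x" and probe_le_2: "probe i z \<epsilon> t r x \<le> 2"
proof -
  let ?\<theta> = "x $ i / r"
  have c: "0 \<le> 1 + cos ?\<theta>" "1 + cos ?\<theta> \<le> 2"
    using cos_ge_minus_one[of ?\<theta>] cos_le_one[of ?\<theta>] by linarith+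
  show "0 \<le> probe i z \<epsilon> t r x"
    unfolding probe_def sep_def mult_1 by (intro mult_nonneg_nonneg bump_nonneg c)
  have "(1 + cos ?\<theta>) * bump ((x $ i - z) / \<epsilon>) * bump ((x $ other i - t) / r) \<le> 2 * 1 * 1"
    using c by (intro mult_mono bump_le_1 mult_nonneg_nonneg bump_nonneg) auto
  then show "probe i z \<epsilon> t r x \<le> 2"
    unfolding probe_def sep_def by simp
qed

lemma sep_bumps_eq_0_outside_strip:
  assumes "0 < \<epsilon>" "0 < r" "x \<notin> strip i z \<epsilon> t r"
  shows "bump ((x $ i - z) / \<epsilon>) = 0 \<or> bump ((x $ other i - t) / r) = 0"
  using assms bump_eq_0[of "(x $ i - z) / \<epsilon>"] bump_eq_0[of "(x $ other i - t) / r"]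
  by (auto simp: strip_def not_le abs_divide)

lemma probe_eq_0:
  assumes "0 < \<epsilon>" "0 < r" "x \<notin> strip i z \<epsilon> t r"
  shows "probe i z \<epsilon> t r x = 0"
  using sep_bumps_eq_0_outside_strip[OF assms] unfolding probe_def sep_def by auto

lemma test_function_probe:
  assumes "0 < \<epsilon>" "0 < r" "strip i z \<epsilon> t r \<subseteq> \<Omega>"
  shows "test_function \<Omega> (probe i z \<epsilon> t r)"
proof -
  have sub: "closure {x. probe i z \<epsilon> t r x \<noteq> 0} \<subseteq> strip i z \<epsilon> t r"
    using probe_eq_0[OF assms(1,2)] compact_imp_closed[OF compact_strip[of i z \<epsilon> t r]]
    by (intro closure_minimal) auto
  then have "compact (closure {x. probe i z \<epsilon> t r x \<noteq> 0})"
    using compact_Int_closed[OF compact_strip[of i z \<epsilon> t r] closed_closure[of "{x. probe i z \<epsilon> t r x \<noteq> 0}"]]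
    by (simp add: Int_absorb1)
  then show ?thesis
    unfolding test_function_def using smooth_probe sub assms(3) by (intro conjI) (assumption | rule order_trans)+
qed

lemma lor_ge: "\<bar>y\<bar> \<le> 1 / 2 \<Longrightarrow> 1 / 2 \<le> lor y"
proof -
  assume "\<bar>y\<bar> \<le> 1 / 2"
  then have "\<bar>y\<bar>\<^sup>2 \<le> (1 / 2)\<^sup>2" by (intro power_mono) auto
  then have "y\<^sup>2 \<le> 1" by (simp add: power2_eq_square)
  then show ?thesis
    unfolding lor_def by (simp add: le_divide_eq)
qed

text \<open>Splitting \<open>cos \<theta> * (1 + cos \<theta>) = 1 / 2 + (cos \<theta> + cos (2 * \<theta>) / 2)\<close>, the constant part gives the
  main term. The bracket is the derivative of a function \<open>v\<close> of size \<open>r\<close>, so integration by parts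
  against the cutoff along the line, whose slope is independent of \<open>r\<close>, makes it an error of order
  \<open>r\<close>.\<close>

lemma integral_block_probe_le:
  assumes \<epsilon>: "0 < \<epsilon>"
  obtains X where "\<And>r. 0 < r \<Longrightarrow>
    (LINT x|lborel. iter_partial [i, i] (block i t r) x * probe i z \<epsilon> t r x)
      \<le> - (exp (- 8) * \<epsilon> / 4 - X * r)"
proof -
  obtain bump' where bump': "\<And>y. (bump has_real_derivative bump' y) (at y)" "smooth1 bump'"
    using smooth1_obtain_deriv[OF smooth1_bump] by blast
  have "bounded (bump' ` {- 1..1})"
    using continuous_on_subset[OF smooth1_continuous[OF bump'(2)]]
    by (intro compact_imp_bounded compact_continuous_image) auto
  then obtain X where X: "0 < X" "\<And>y. \<bar>y\<bar> \<le> 1 \<Longrightarrow> \<bar>bump' y\<bar> \<le> X"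
    by (auto simp: bounded_pos abs_le_iff)
  have "(LINT x|lborel. iter_partial [i, i] (block i t r) x * probe i z \<epsilon> t r x)
      \<le> - (exp (- 8) * \<epsilon> / 4 - 8 * X * r)" if r: "0 < r" for r
  proof -
    define S where "S = strip i z \<epsilon> t r"
    define S' where "S' = strip i z (\<epsilon> / 2) t (r / 2)"
    define k where "k y = 1 / r * (lor ((y - t) / r) * bump ((y - t) / r))" for y
    define K where "K = sep i (\<lambda>y. bump ((y - z) / \<epsilon>)) k"
    define v where "v = sep i (\<lambda>y. r * sin (y / r) + r / 4 * sin (y / (r / 2))) (\<lambda>_. 1)"
    have compS: "compact S"
      unfolding S_def by (rule compact_strip)
    then have closedS: "closed S"
      by (rule compact_imp_closed)
    have smk: "smooth1 k"
      unfolding k_def[abs_def]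
      by (rule smooth1_mult[OF smooth1_const smooth1_mult[OF
            smooth1_rescale[OF smooth1_lor] smooth1_rescale[OF smooth1_bump]]])
    have smK: "smooth K"
      unfolding K_def by (rule smooth_sep[OF smooth1_rescale[OF smooth1_bump] smk])
    have smv: "smooth v"
      unfolding v_def by (rule smooth_sep[OF smooth1_add[OF smooth1_wave[OF smooth1_sin]
            smooth1_wave[OF smooth1_sin]] smooth1_const])
    have r2: "0 < r / 2" using r by simp
    have Dv: "partial_deriv i v = sep i (\<lambda>y. r / r * cos (y / r) + r / 4 / (r / 2) * cos (y / (r / 2))) (\<lambda>_. 0 + 1)"
    proof -
      have "partial_deriv i v = sep i (\<lambda>y. r / r * cos (y / r) + r / 4 / (r / 2) * cos (y / (r / 2))) (\<lambda>_. 1)"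
        unfolding v_def
        by (rule partial_deriv_sep(1)[OF DERIV_add[OF sin_wave_deriv[OF r] sin_wave_deriv[OF r2]] DERIV_const])
      then show ?thesis by simp
    qed
    have K0: "K x = 0" if "x \<notin> S" for x
      using sep_bumps_eq_0_outside_strip[OF \<epsilon> r] that
      unfolding K_def S_def sep_def k_def by fastforce
    have DK0: "partial_deriv i K x = 0" if "x \<notin> S" for x
      by (rule partial_deriv_eq_0_outside[OF closedS K0 that])
    have DK: "partial_deriv i K = sep i (\<lambda>y. bump' ((y - z) / \<epsilon>) / \<epsilon>) k"
    proof -
      obtain k' where "\<And>y. (k has_real_derivative k' y) (at y)"
        using smooth1_obtain_deriv[OF smk] by blast
      then show ?thesis
        unfolding K_def by (rule partial_deriv_sep(1)[OF deriv_rescale[OF bump'(1)]])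
    qed
    have k_bound: "0 \<le> k y" "k y \<le> 1 / r" for y
    proof -
      show "0 \<le> k y"
        unfolding k_def using r lor_pos bump_nonneg by (simp add: less_imp_le)
      have "lor ((y - t) / r) * bump ((y - t) / r) \<le> 1 * 1"
        by (intro mult_mono lor_le_1 bump_le_1 bump_nonneg) simp
      then have "1 / r * (lor ((y - t) / r) * bump ((y - t) / r)) \<le> 1 / r * (1 * 1)"
        using r by (intro mult_left_mono) auto
      then show "k y \<le> 1 / r"
        by (simp add: k_def)
    qed
    have v_bound: "\<bar>v x\<bar> \<le> 2 * r" for x
    proof -
      have "\<bar>sin (x $ i / r)\<bar> \<le> 1" "\<bar>sin (x $ i / (r / 2))\<bar> \<le> 1"
        by simp_all
      then have "r * \<bar>sin (x $ i / r)\<bar> \<le> r * 1" "r / 4 * \<bar>sin (x $ i / (r / 2))\<bar> \<le> r / 4 * 1"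
        using r by (intro mult_left_mono; simp)+
      moreover have "\<bar>v x\<bar> \<le> r * \<bar>sin (x $ i / r)\<bar> + r / 4 * \<bar>sin (x $ i / (r / 2))\<bar>"
        unfolding v_def sep_def using r abs_triangle_ineq[of "r * sin (x $ i / r)" "r / 4 * sin (x $ i / (r / 2))"]
        by (simp add: abs_mult)
      ultimately show ?thesis using r by linarith
    qed
    have vDK_bound: "\<bar>v x * partial_deriv i K x\<bar> \<le> 2 * X / \<epsilon> * indicator S x" for x
    proof (cases "x \<in> S")
      case True
      then have "\<bar>(x $ i - z) / \<epsilon>\<bar> \<le> 1"
        using \<epsilon> by (simp add: S_def strip_def abs_divide)
      then have "\<bar>bump' ((x $ i - z) / \<epsilon>) / \<epsilon>\<bar> \<le> X / \<epsilon>"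
        using X(2) \<epsilon> by (simp add: abs_divide divide_right_mono)
      then have "\<bar>bump' ((x $ i - z) / \<epsilon>) / \<epsilon>\<bar> * \<bar>k (x $ other i)\<bar> \<le> X / \<epsilon> * (1 / r)"
        using k_bound X(1) \<epsilon> by (intro mult_mono) auto
      then have "\<bar>v x\<bar> * \<bar>partial_deriv i K x\<bar> \<le> 2 * r * (X / \<epsilon> * (1 / r))"
        unfolding DK sep_def abs_mult
        by (rule mult_mono[OF v_bound]) (use r in auto)
      with True r show ?thesis by (simp add: abs_mult)
    qed (simp add: DK0)
    have intK: "integrable lborel K"
      by (rule integrable_compact_support[OF smooth_continuous[OF smK] compS K0])
    have intDvK: "integrable lborel (\<lambda>x. partial_deriv i v x * K x)"
      by (rule integrable_compact_support[OF _ compS])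
         (intro continuous_intros smooth_continuous smooth_partial_deriv smK smv, simp add: K0)
    have intvDK: "integrable lborel (\<lambda>x. v x * partial_deriv i K x)"
      by (rule integrable_compact_support[OF _ compS])
         (intro continuous_intros smooth_continuous smooth_partial_deriv smK smv, simp add: DK0)
    have eq: "iter_partial [i, i] (block i t r) x * probe i z \<epsilon> t r x
        = - (1 / 2 * K x + partial_deriv i v x * K x)" for x
    proof -
      let ?\<theta> = "x $ i / r"
      have "x $ i / (r / 2) = 2 * ?\<theta>" by simp
      then have D: "partial_deriv i v x = cos ?\<theta> + 1 / 2 * (2 * (cos ?\<theta>)\<^sup>2 - 1)"
        unfolding Dv sep_def using r by (simp only: cos_double_cos) simp
      have "1 / 2 * K x + partial_deriv i v x * K x = cos ?\<theta> * (1 + cos ?\<theta>) * K x"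
        unfolding D by (simp add: algebra_simps power2_eq_square)
      also have "\<dots> = - (iter_partial [i, i] (block i t r) x * probe i z \<epsilon> t r x)"
        unfolding iter_partial_Cons iter_partial_Nil partial_block_dd[OF r] probe_def K_def sep_def k_def
        by (simp add: mult_ac)
      finally show ?thesis by linarith
    qed
    have "exp (- 8) * \<epsilon> / 2 = (LINT x|lborel. exp (- 8) / (2 * r) * indicator S' x)"
      using integral_indicator_strip(1)[of "\<epsilon> / 2" "r / 2" i z t] \<epsilon> r
      unfolding S'_def by (simp del: integral_indicator)
    also have "\<dots> \<le> (LINT x|lborel. K x)"
    proof (rule integral_mono')
      fix x
      show nn: "0 \<le> K x"
        unfolding K_def sep_def using bump_nonneg k_bound by simp
      show "exp (- 8) / (2 * r) * indicator S' x \<le> K x"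
      proof (cases "x \<in> S'")
        case True
        have s: "\<bar>(x $ i - z) / \<epsilon>\<bar> \<le> 1 / 2" "\<bar>(x $ other i - t) / r\<bar> \<le> 1 / 2"
          using True \<epsilon> r by (auto simp: S'_def strip_def abs_divide field_simps)
        have "exp (- 4) * (1 / r * (1 / 2 * exp (- 4))) \<le> K x"
          unfolding K_def sep_def k_def using s r lor_pos
          by (intro mult_mono bump_ge lor_ge bump_nonneg mult_nonneg_nonneg) (auto simp: less_imp_le)
        moreover have "exp (- 4) * (1 / r * (1 / 2 * exp (- 4))) = exp (- 8) / (2 * r)"
          by (simp flip: exp_add)
        ultimately show ?thesis using True by simp
      qed (use nn in simp)
    qed (rule intK)
    finally have K_ge: "exp (- 8) * \<epsilon> / 2 \<le> (LINT x|lborel. K x)" .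
    have "(LINT x|lborel. partial_deriv i v x * K x) = - (LINT x|lborel. v x * partial_deriv i K x)"
      using integration_by_parts[OF smv smK compS K0, of i] by simp
    moreover have "\<bar>LINT x|lborel. v x * partial_deriv i K x\<bar> \<le> (LINT x|lborel. 2 * X / \<epsilon> * indicator S x)"
      using vDK_bound integral_indicator_strip(2)[of \<epsilon> r i z t] \<epsilon> r
      by (intro integral_abs_bound_integral intvDK integrable_mult_right) (auto simp: S_def)
    moreover have "(LINT x|lborel. 2 * X / \<epsilon> * indicator S x) = 8 * X * r"
      using integral_indicator_strip(1)[of \<epsilon> r i z t] \<epsilon> r
      unfolding S_def by (simp del: integral_indicator)
    ultimately have DvK_ge: "- (8 * X * r) \<le> (LINT x|lborel. partial_deriv i v x * K x)"
      by linarith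
    have "(LINT x|lborel. iter_partial [i, i] (block i t r) x * probe i z \<epsilon> t r x)
        = - (1 / 2 * (LINT x|lborel. K x) + (LINT x|lborel. partial_deriv i v x * K x))"
      unfolding eq using intK intDvK by simp
    with K_ge DvK_ge show ?thesis by linarith
  qed
  then show ?thesis by (rule that)
qed

section \<open>Lower bounds for integrals against test functions\<close>

text \<open>A substitute for Hoelder's inequality with a free threshold \<open>\<Lambda>\<close>: the part of \<open>neg_part g\<close> below
  \<open>\<Lambda>\<close> is estimated by the measure of the support, the part above it by its \<open>q\<close>-th power.\<close>

lemma integral_ge_of_neg_part_Lp:
  fixes g \<phi> :: "real^'n::finite \<Rightarrow> real"
  assumes g: "loc_integrable \<Omega> g" "in_Lp \<Omega>' q (neg_part g)" "1 < q"
    and sets: "\<Omega> \<in> sets lebesgue" "\<Omega>' \<in> sets lebesgue" "compact S" "S \<subseteq> \<Omega>'" "\<Omega>' \<subseteq> \<Omega>"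
    and \<phi>: "continuous_on UNIV \<phi>" "\<And>x. 0 \<le> \<phi> x" "\<And>x. \<phi> x \<le> B" "\<And>x. x \<notin> S \<Longrightarrow> \<phi> x = 0"
    and \<Lambda>: "0 < \<Lambda>"
  shows "- (B * (\<Lambda> * measure lborel S
            + \<Lambda> powr (1 - q) * (LINT x|lebesgue_on \<Omega>'. \<bar>neg_part g x\<bar> powr q)))
         \<le> (LINT x|lebesgue_on \<Omega>. g x * \<phi> x)"
proof -
  have S: "S \<in> sets lebesgue" "emeasure lebesgue S < \<infinity>"
    using sets(3) emeasure_bounded_finite[OF compact_imp_bounded]
    by (auto simp: compact_imp_closed)
  define N where "N x = indicator \<Omega>' x *\<^sub>R (\<bar>neg_part g x\<bar> powr q)" for x
  have B: "0 \<le> B" using order_trans[OF \<phi>(2,3)] .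
  have intN: "integrable lebesgue N"
    using g(2) sets(2) unfolding in_Lp_def N_def[abs_def] by (subst (asm) integrable_restrict_space) auto
  have "integrable (lebesgue_on S) g"
    using g(1) sets unfolding loc_integrable_def by (meson order_trans)
  then have intg: "integrable lebesgue (\<lambda>x. indicator S x *\<^sub>R g x)"
    using S(1) by (subst (asm) integrable_restrict_space) auto
  have meas: "\<phi> \<in> borel_measurable lebesgue"
    using borel_measurable_continuous_onI[OF \<phi>(1)] by (intro measurable_completion) simp
  have int: "integrable lebesgue (\<lambda>x. (indicator S x *\<^sub>R g x) * \<phi> x)"
  proof (rule Bochner_Integration.integrable_bound)
    show "integrable lebesgue (\<lambda>x. B * (indicator S x *\<^sub>R g x))"
      by (intro integrable_mult_right intg)
    show "AE x in lebesgue. norm ((indicator S x *\<^sub>R g x) * \<phi> x) \<le> norm (B * (indicator S x *\<^sub>R g x))"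
    proof (intro AE_I2)
      fix x
      have "\<bar>\<phi> x\<bar> \<le> \<bar>B\<bar>" using \<phi>(2,3)[of x] by simp
      then show "norm ((indicator S x *\<^sub>R g x) * \<phi> x) \<le> norm (B * (indicator S x *\<^sub>R g x))"
        unfolding real_norm_def abs_mult by (subst mult.commute) (intro mult_right_mono, auto)
    qed
    show "(\<lambda>x. (indicator S x *\<^sub>R g x) * \<phi> x) \<in> borel_measurable lebesgue"
      using intg meas by (intro borel_measurable_times) auto
  qed
  have int': "integrable lebesgue (\<lambda>x. - (B * (\<Lambda> * indicator S x + \<Lambda> powr (1 - q) * N x)))"
    using S intN by (intro Bochner_Integration.integrable_minus integrable_mult_right Bochner_Integration.integrable_add integrable_real_indicator)
  have le: "- (B * (\<Lambda> * indicator S x + \<Lambda> powr (1 - q) * N x)) \<le> (indicator S x *\<^sub>R g x) * \<phi> x" for x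
  proof (cases "x \<in> S")
    case True
    then have N: "N x = neg_part g x powr q"
      using sets by (auto simp: N_def neg_part_def)
    have nn: "0 \<le> neg_part g x" by (simp add: neg_part_def)
    have young: "neg_part g x \<le> \<Lambda> + \<Lambda> powr (1 - q) * N x"
    proof (cases "neg_part g x \<le> \<Lambda>")
      case True
      then show ?thesis by (simp add: N add_increasing2)
    next
      case False
      then have pos: "\<Lambda> < neg_part g x" by simp
      have "neg_part g x = neg_part g x powr (1 - q) * neg_part g x powr q"
        using pos \<Lambda> by (simp flip: powr_add)
      also have "\<dots> \<le> \<Lambda> powr (1 - q) * neg_part g x powr q"
        using pos \<Lambda> g(3) by (intro mult_right_mono powr_mono2') auto
      finally show ?thesis using \<Lambda> N by simp
    qed
    have "neg_part g x * \<phi> x \<le> (\<Lambda> + \<Lambda> powr (1 - q) * N x) * B"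
      using young nn \<phi>(2,3)[of x] by (intro mult_mono) auto
    moreover have "- (neg_part g x * \<phi> x) \<le> g x * \<phi> x"
      using mult_right_mono[of "- neg_part g x" "g x" "\<phi> x"] \<phi>(2)[of x] by (auto simp: neg_part_def)
    ultimately show ?thesis using True by (simp add: mult.commute)
  next
    case False
    have "0 \<le> B * (\<Lambda> powr (1 - q) * N x)"
      using B by (simp add: N_def)
    then show ?thesis using False by simp
  qed
  have "(LINT x|lebesgue. - (B * (\<Lambda> * indicator S x + \<Lambda> powr (1 - q) * N x)))
      \<le> (LINT x|lebesgue. (indicator S x *\<^sub>R g x) * \<phi> x)"
    by (intro integral_mono int int' le)
  moreover have "(LINT x|lebesgue. - (B * (\<Lambda> * indicator S x + \<Lambda> powr (1 - q) * N x)))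
      = - (B * (\<Lambda> * measure lborel S + \<Lambda> powr (1 - q) * (LINT x|lebesgue. N x)))"
  proof -
    have "integrable lebesgue (\<lambda>x. \<Lambda> * indicator S x)" "integrable lebesgue (\<lambda>x. \<Lambda> powr (1 - q) * N x)"
      using S intN by (auto intro!: integrable_mult_right integrable_real_indicator)
    then show ?thesis
      using S sets(3) by (simp add: compact_imp_closed)
  qed
  moreover have "(LINT x|lebesgue. N x) = (LINT x|lebesgue_on \<Omega>'. \<bar>neg_part g x\<bar> powr q)"
    unfolding N_def using sets(2) by (subst integral_restrict_space) auto
  moreover have "(LINT x|lebesgue. (indicator S x *\<^sub>R g x) * \<phi> x) = (LINT x|lebesgue_on \<Omega>. g x * \<phi> x)"
  proof -
    have "(\<lambda>x. (indicator S x *\<^sub>R g x) * \<phi> x) = (\<lambda>x. indicator \<Omega> x *\<^sub>R (g x * \<phi> x))"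
      using sets \<phi>(4) by (auto simp: indicator_def fun_eq_iff)
    then show ?thesis
      using sets(1) by (subst integral_restrict_space) auto
  qed
  ultimately show ?thesis by (simp only:)
qed

section \<open>Amplitudes and widths\<close>

text \<open>Three relations between these sequences are used: the sum of all later amplitudes is negligible
  against \<open>amp k\<close>, the second derivatives of all earlier blocks, integrated over a strip of width
  \<open>width k\<close>, are negligible against \<open>amp k\<close>, and so is every positive power of \<open>width k\<close>.\<close>

definition amp :: "nat \<Rightarrow> real" where "amp m = (1 / 2) ^ (m\<^sup>2)"
definition width :: "nat \<Rightarrow> real" where "width m = (1 / 2) ^ (m ^ 3)"

lemma amp_pos: "0 < amp m" and amp_le_1: "amp m \<le> 1"
  and width_pos: "0 < width m" and width_le_1: "width m \<le> 1"
  by (auto simp: amp_def width_def power_le_one)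

lemma amp_tail_le: "amp (j + Suc k) \<le> amp k * (1 / 2) ^ k * (1 / 2) ^ Suc j"
proof -
  have "k\<^sup>2 + k + Suc j \<le> (j + Suc k)\<^sup>2"
    by (simp add: power2_eq_square algebra_simps)
  then have "amp (j + Suc k) \<le> (1 / 2) ^ (k\<^sup>2 + k + Suc j)"
    unfolding amp_def by (intro power_decreasing) auto
  then show ?thesis by (simp add: amp_def power_add)
qed

lemma summable_amp: "summable amp"
proof -
  have "summable (\<lambda>j. (1 / 2) ^ Suc j :: real)"
    by (simp add: summable_geometric)
  then have "summable (\<lambda>j. amp (j + Suc 0))"
    by (rule summable_comparison_test'[of _ 0]) (use amp_tail_le[of _ 0] amp_pos in \<open>auto simp: amp_def\<close>)
  then show ?thesis
    by (subst (asm) summable_iff_shift)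
qed

lemma suminf_amp_tail_le: "(\<Sum>j. amp (j + Suc k)) \<le> amp k * (1 / 2) ^ k"
proof -
  have s: "(\<lambda>j. amp k * (1 / 2) ^ k * (1 / 2) ^ Suc j) sums (amp k * (1 / 2) ^ k * 1)"
    by (intro sums_mult power_half_series)
  have "(\<Sum>j. amp (j + Suc k)) \<le> (\<Sum>j. amp k * (1 / 2) ^ k * (1 / 2) ^ Suc j)"
    by (intro suminf_le amp_tail_le sums_summable[OF s])
       (use summable_amp in \<open>simp only: summable_iff_shift\<close>)
  also have "\<dots> = amp k * (1 / 2) ^ k"
    using sums_unique[OF s] by simp
  finally show ?thesis .
qed

lemma width_sum_le: "width k * (\<Sum>m<k. amp m / width m) \<le> amp k * (2 * real k * (1 / 2) ^ k)"
proof (cases k)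
  case (Suc j)
  have "width k * (amp m / width m) \<le> amp k * (2 * (1 / 2) ^ k)" if "m < k" for m
  proof -
    have "m ^ 3 \<le> j ^ 3" using that Suc by (intro power_mono) auto
    moreover have "k ^ 3 = j ^ 3 + 3 * j\<^sup>2 + 3 * j + 1" "k\<^sup>2 = j\<^sup>2 + 2 * j + 1"
      by (simp_all add: Suc power2_eq_square power3_eq_cube algebra_simps)
    ultimately have le: "m ^ 3 + k\<^sup>2 + j \<le> k ^ 3" by linarith
    have "width k * amp m \<le> width k * 1"
      using width_pos[of k] amp_le_1[of m] by (intro mult_left_mono) auto
    also have "\<dots> \<le> (1 / 2) ^ (m ^ 3 + k\<^sup>2 + j)"
      using le unfolding width_def by (simp add: power_decreasing)
    also have "\<dots> = width m * (amp k * (2 * (1 / 2) ^ k))"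
      by (simp add: width_def amp_def power_add Suc)
    finally show ?thesis
      using width_pos[of m] by (simp add: field_simps)
  qed
  then have "(\<Sum>m<k. width k * (amp m / width m)) \<le> real (card {..<k}) * (amp k * (2 * (1 / 2) ^ k))"
    by (intro sum_bounded_above) auto
  also have "(\<Sum>m<k. width k * (amp m / width m)) = width k * (\<Sum>m<k. amp m / width m)"
    by (rule sum_distrib_left[symmetric])
  also have "real (card {..<k}) * (amp k * (2 * (1 / 2) ^ k)) = amp k * (2 * real k * (1 / 2) ^ k)"
    by (simp add: ac_simps)
  finally show ?thesis .
next
  case 0
  then show ?thesis by simp
qed

lemma width_powr_over_amp_tendsto_0:
  assumes "0 < s"
  shows "(\<lambda>k. width k powr s / amp k) \<longlonglongrightarrow> 0"
proof -
  have half: "(1 / 2 :: real) ^ n = 2 powr - real n" for n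
    by (simp add: powr_minus powr_realpow power_divide inverse_eq_divide)
  have "width k powr s / amp k = 2 powr ((real k)\<^sup>2 - s * real k ^ 3)" for k
    unfolding width_def amp_def half
    by (simp add: powr_powr powr_diff[symmetric] mult.commute)
  moreover have "\<forall>\<^sub>F k in sequentially. 2 powr ((real k)\<^sup>2 - s * real k ^ 3) \<le> (1 / 2) ^ k"
  proof -
    have "\<forall>\<^sub>F k in sequentially. max 1 (2 / s) \<le> real k"
      using filterlim_real_sequentially unfolding filterlim_at_top by blast
    then show ?thesis
    proof eventually_elim
      case (elim k)
      then have k: "1 \<le> real k" "2 \<le> s * real k"
        using assms by (auto simp: field_simps)
      have "2 * (real k)\<^sup>2 \<le> (s * real k) * (real k)\<^sup>2"
        using k by (intro mult_right_mono) auto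
      moreover have "real k * 1 \<le> real k * real k"
        using k by (intro mult_left_mono) auto
      ultimately have "(real k)\<^sup>2 - s * real k ^ 3 \<le> - real k"
        by (simp add: power2_eq_square power3_eq_cube algebra_simps)
      then show ?case
        unfolding half by (intro powr_mono) auto
    qed
  qed
  ultimately show ?thesis
    using width_pos amp_pos
    by (intro tendsto_sandwich[OF _ _ tendsto_const LIMSEQ_realpow_zero[of "1 / 2"]]) auto
qed

section \<open>Superposition of blocks\<close>

lemma iter_partial_cmult:
  assumes "smooth f"
  shows "iter_partial a (\<lambda>x. c * f x) = (\<lambda>x. c * iter_partial a f x)"
proof (induction a)
  case (Cons i a)
  show ?case
  proof
    fix x
    have "((\<lambda>x. c * iter_partial a f x) has_derivative
        (\<lambda>h. c * frechet_derivative (iter_partial a f) (at x) h)) (at x)"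
      by (intro has_derivative_mult_right differentiable_has_derivative
          smooth_differentiable smooth_iter_partial assms)
    from partial_deriv_eqI[OF this]
    show "iter_partial (i # a) (\<lambda>x. c * f x) x = c * iter_partial (i # a) f x"
      unfolding iter_partial_Cons Cons by (simp add: partial_deriv_def)
  qed
qed simp

lemma smooth_cmult:
  assumes "smooth f"
  shows "smooth (\<lambda>x. c * f x)"
  unfolding smooth_def iter_partial_cmult[OF assms]
  by (intro allI differentiable_mult differentiable_const smooth_differentiable smooth_iter_partial assms)

text \<open>The list \<open>a\<close> makes one definition cover the function itself (\<open>a = []\<close>) and the candidates for
  its weak derivatives.\<close>

definition series :: "(nat \<Rightarrow> 2) \<Rightarrow> (nat \<Rightarrow> real) \<Rightarrow> 2 list \<Rightarrow> real^2 \<Rightarrow> real" where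
  "series d t a x = (\<Sum>m. amp m * iter_partial a (block (d m) (t m) (width m)) x)"

lemma summable_cmult_amp: "summable (\<lambda>m. amp m * c)"
  using summable_amp by (rule summable_mult2)

context
  fixes d :: "nat \<Rightarrow> 2" and t :: "nat \<Rightarrow> real"
  assumes t: "\<And>m. \<bar>t m\<bar> \<le> 1"
begin

lemma integrable_block_term:
  "integrable (lebesgue_on (ball 0 1)) (\<lambda>x. amp m * iter_partial a (block (d m) (t m) (width m)) x)"
  by (intro integrable_mult_right integrable_on_ball smooth_continuous smooth_iter_partial smooth_block)

lemma summable_integral_block_term:
  assumes "length a \<le> 2"
  shows "summable (\<lambda>m. LINT x|lebesgue_on (ball 0 1).
           \<bar>amp m * iter_partial a (block (d m) (t m) (width m)) x\<bar>)"
proof -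
  obtain C where C0: "0 \<le> C" and C: "\<And>d t r a. 0 < r \<Longrightarrow> r \<le> 1 \<Longrightarrow> \<bar>t\<bar> \<le> 1 \<Longrightarrow> length a \<le> 2 \<Longrightarrow>
       (LINT x|lebesgue_on (ball 0 1). \<bar>iter_partial a (block d t r) x\<bar>) \<le> C"
    by (rule integral_block_bounded) blast
  show ?thesis
  proof (rule summable_comparison_test'[OF summable_cmult_amp[of C], of 0])
    fix m
    have "amp m * (LINT x|lebesgue_on (ball 0 1). \<bar>iter_partial a (block (d m) (t m) (width m)) x\<bar>) \<le> amp m * C"
      using amp_pos[of m] by (intro mult_left_mono C width_pos width_le_1 t assms) simp
    then show "norm (LINT x|lebesgue_on (ball 0 1). \<bar>amp m * iter_partial a (block (d m) (t m) (width m)) x\<bar>)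
        \<le> amp m * C"
      using amp_pos[of m] by (simp add: abs_mult)
  qed
qed

lemma integrable_series:
  assumes "length a \<le> 2"
  shows "integrable (lebesgue_on (ball 0 1)) (series d t a)"
  unfolding series_def[abs_def]
  by (rule integral_suminf_times_bounded(1)[OF integrable_block_term
        summable_integral_block_term[OF assms], of "\<lambda>_. 0" 0]) auto

lemma weak_deriv_series:
  assumes "length a \<le> 2"
  shows "weak_deriv (ball 0 1) a (series d t []) (series d t (rev a))"
  unfolding series_def[abs_def]
proof (rule weak_deriv_suminf)
  fix m
  show "weak_deriv (ball 0 1) a (\<lambda>x. amp m * iter_partial [] (block (d m) (t m) (width m)) x)
      (\<lambda>x. amp m * iter_partial (rev a) (block (d m) (t m) (width m)) x)"
    using weak_deriv_smooth[OF smooth_cmult[OF smooth_block], of "ball 0 1" a "amp m" "d m" "t m" "width m"]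
    by (simp add: iter_partial_cmult smooth_block)
qed (use assms in \<open>simp_all only: integrable_block_term summable_integral_block_term list.size
       length_rev, auto\<close>)

lemma series_test_sums:
  assumes "length a \<le> 2" "test_function \<Omega> \<phi>"
  shows "(\<lambda>m. amp m * (LINT x|lebesgue_on (ball 0 1). iter_partial a (block (d m) (t m) (width m)) x * \<phi> x))
    sums (LINT x|lebesgue_on (ball 0 1). series d t a x * \<phi> x)"
proof -
  obtain K where K: "smooth \<phi>" "compact K" "K \<subseteq> \<Omega>" "\<And>x. x \<notin> K \<Longrightarrow> \<phi> x = 0"
    using test_functionD[OF assms(2)] by blast
  obtain B where B: "\<And>x. \<bar>iter_partial [] \<phi> x\<bar> \<le> B"
    using smooth_compact_support_bounded[OF K(1,2,4)] by blast
  have "(\<lambda>m. LINT x|lebesgue_on (ball 0 1). amp m * iter_partial a (block (d m) (t m) (width m)) x * \<phi> x)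
    sums (LINT x|lebesgue_on (ball 0 1). series d t a x * \<phi> x)"
    unfolding series_def
    by (rule integral_suminf_times_bounded(2)[OF integrable_block_term
          summable_integral_block_term[OF assms(1)] _ B[unfolded iter_partial_Nil]])
       (intro continuous_borel_measurable_lebesgue_on smooth_continuous K)
  then show ?thesis
    by (simp only: mult.assoc integral_mult_right_zero)
qed

lemma lipschitz_series: "(30 * (\<Sum>m. amp m))-lipschitz_on (ball 0 1) (series d t [])"
proof (rule lipschitz_onI)
  fix x y :: "real^2"
  assume xy: "x \<in> ball 0 1" "y \<in> ball 0 1"
  let ?b = "\<lambda>m. block (d m) (t m) (width m)"
  have sm: "summable (\<lambda>m. amp m * ?b m x)" if "x \<in> ball 0 1" for x
  proof (rule summable_comparison_test'[OF summable_cmult_amp[of 29], of 0])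
    fix m
    show "norm (amp m * ?b m x) \<le> amp m * 29"
      using abs_block_le[OF width_pos that t width_le_1] amp_pos[of m]
      by (simp add: abs_mult mult_left_mono)
  qed
  have le: "\<bar>amp m * ?b m x - amp m * ?b m y\<bar> \<le> amp m * (30 * dist x y)" for m
  proof -
    have "dist (?b m x) (?b m y) \<le> 30 * dist x y"
      by (rule lipschitz_onD[OF lipschitz_block[OF width_pos, of UNIV]]) auto
    then have "amp m * \<bar>?b m x - ?b m y\<bar> \<le> amp m * (30 * dist x y)"
      using amp_pos[of m] by (simp add: dist_real_def)
    then show ?thesis
      using amp_pos[of m] by (simp add: abs_mult flip: right_diff_distrib)
  qed
  have sabs: "summable (\<lambda>m. \<bar>amp m * ?b m x - amp m * ?b m y\<bar>)"
    by (rule summable_comparison_test'[OF summable_cmult_amp[of "30 * dist x y"], of 0]) (use le in simp)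
  have "dist (series d t [] x) (series d t [] y) = \<bar>\<Sum>m. amp m * ?b m x - amp m * ?b m y\<bar>"
    unfolding series_def dist_real_def iter_partial_Nil by (simp only: suminf_diff sm xy)
  also have "\<dots> \<le> (\<Sum>m. \<bar>amp m * ?b m x - amp m * ?b m y\<bar>)"
    by (rule summable_rabs[OF sabs])
  also have "\<dots> \<le> (\<Sum>m. amp m * (30 * dist x y))"
    by (rule suminf_le[OF le sabs summable_cmult_amp])
  also have "\<dots> = 30 * (\<Sum>m. amp m) * dist x y"
    using suminf_mult2[OF summable_amp, of "30 * dist x y"] by simp
  finally show "dist (series d t [] x) (series d t [] y) \<le> 30 * (\<Sum>m. amp m) * dist x y" .
next
  show "0 \<le> 30 * (\<Sum>m. amp m)"
    using suminf_nonneg[OF summable_amp] amp_pos by (simp add: less_imp_le)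
qed

lemma sobolev_series: "sobolev 2 1 (ball 0 1) (series d t [])"
proof -
  have Lp: "in_Lp (ball 0 1) 1 (series d t a)" if "length a \<le> 2" for a
    using integrable_series[OF that] unfolding in_Lp_def by (auto intro: borel_measurable_integrable)
  show ?thesis
    unfolding sobolev_def
  proof (intro conjI allI impI)
    fix a :: "2 list" assume "length a \<le> 2"
    then show "\<exists>g. weak_deriv (ball 0 1) a (series d t []) g \<and> in_Lp (ball 0 1) 1 g"
      by (intro exI[of _ "series d t (rev a)"] conjI weak_deriv_series Lp) auto
  qed (intro Lp, simp)
qed

text \<open>The integral against the Laplacian of a test function is a sum over the blocks, and the
  Laplacian of each block is nonnegative.\<close>

lemma distr_subharmonic_series: "distr_subharmonic (ball 0 1) (series d t [])"
  unfolding distr_subharmonic_def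
proof (intro conjI allI impI)
  show "loc_integrable (ball 0 1) (series d t [])"
    by (intro integrable_imp_loc_integrable integrable_series) auto
next
  fix \<phi> :: "real^2 \<Rightarrow> real"
  assume \<phi>: "test_function (ball 0 1) \<phi> \<and> (\<forall>x. 0 \<le> \<phi> x)"
  let ?M = "lebesgue_on (ball (0 :: real^2) 1)"
  let ?b = "\<lambda>m. block (d m) (t m) (width m)"
  obtain K where K: "smooth \<phi>" "compact K" "K \<subseteq> ball 0 1" "\<And>x. x \<notin> K \<Longrightarrow> \<phi> x = 0"
    using test_functionD \<phi> by blast
  have int_times: "integrable ?M (\<lambda>x. series d t [] x * iter_partial a \<phi> x)" for a
  proof -
    obtain B where B: "\<And>x. \<bar>iter_partial a \<phi> x\<bar> \<le> B"
      using smooth_compact_support_bounded[OF K(1,2,4)] by blast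
    show ?thesis
    proof (rule Bochner_Integration.integrable_bound)
      show "integrable ?M (\<lambda>x. B * series d t [] x)"
        by (intro integrable_mult_right integrable_series) simp
      show "(\<lambda>x. series d t [] x * iter_partial a \<phi> x) \<in> borel_measurable ?M"
        by (intro borel_measurable_times borel_measurable_integrable integrable_series
            continuous_borel_measurable_lebesgue_on smooth_continuous smooth_iter_partial K) simp
      show "AE x in ?M. norm (series d t [] x * iter_partial a \<phi> x) \<le> norm (B * series d t [] x)"
      proof (intro AE_I2)
        fix x
        have "\<bar>iter_partial a \<phi> x\<bar> \<le> \<bar>B\<bar>" using B[of x] by simp
        then show "norm (series d t [] x * iter_partial a \<phi> x) \<le> norm (B * series d t [] x)"
          unfolding real_norm_def abs_mult by (subst mult.commute) (intro mult_right_mono, auto)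
      qed
    qed
  qed
  have "(LINT x|?M. series d t [] x * laplacian \<phi> x)
      = (\<Sum>i\<in>UNIV. LINT x|?M. series d t [] x * iter_partial [i, i] \<phi> x)"
    unfolding laplacian_def sum_distrib_left by (intro Bochner_Integration.integral_sum int_times)
  also have "\<dots> = (\<Sum>i\<in>UNIV. LINT x|?M. series d t [i, i] x * \<phi> x)"
  proof (intro sum.cong refl)
    fix i
    show "(LINT x|?M. series d t [] x * iter_partial [i, i] \<phi> x) = (LINT x|?M. series d t [i, i] x * \<phi> x)"
      using weak_deriv_series[of "[i, i]"] \<phi> unfolding weak_deriv_def by simp
  qed
  finally have eq: "(LINT x|?M. series d t [] x * laplacian \<phi> x)
      = (\<Sum>i\<in>UNIV. LINT x|?M. series d t [i, i] x * \<phi> x)" .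
  have S: "(\<lambda>m. \<Sum>i\<in>UNIV. amp m * (LINT x|?M. iter_partial [i, i] (?b m) x * \<phi> x))
      sums (\<Sum>i\<in>UNIV. LINT x|?M. series d t [i, i] x * \<phi> x)"
    by (intro sums_sum series_test_sums[where \<Omega> = "ball 0 1"]) (use \<phi> in auto)
  have N: "0 \<le> (\<Sum>i\<in>UNIV. amp m * (LINT x|?M. iter_partial [i, i] (?b m) x * \<phi> x))" for m
  proof -
    have int: "integrable ?M (\<lambda>x. iter_partial [i, i] (?b m) x * \<phi> x)" for i
      by (intro integrable_on_ball continuous_intros smooth_continuous smooth_iter_partial smooth_block K)
    have "(\<Sum>i\<in>UNIV. LINT x|?M. iter_partial [i, i] (?b m) x * \<phi> x)
        = (LINT x|?M. (\<Sum>i\<in>UNIV. iter_partial [i, i] (?b m) x) * \<phi> x)"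
      unfolding sum_distrib_right by (intro Bochner_Integration.integral_sum[symmetric] int)
    also have "0 \<le> \<dots>"
    proof (intro integral_nonneg_AE AE_I2 mult_nonneg_nonneg)
      show "0 \<le> (\<Sum>i\<in>UNIV. iter_partial [i, i] (?b m) x)" for x
        using laplacian_block_nonneg[OF width_pos, of "d m" "t m" m x] by (simp add: iter_partial_Cons)
    qed (use \<phi> in blast)
    finally show ?thesis
      using amp_pos[of m] by (simp flip: sum_distrib_left)
  qed
  show "0 \<le> (LINT x|?M. series d t [] x * laplacian \<phi> x)"
    unfolding eq by (rule sums_le[OF N sums_zero S])
qed

section \<open>Failure of integrability\<close>

text \<open>Of the three groups of blocks, block \<open>k\<close> itself gives the negative term. The blocks before it
  are bounded pointwise by a multiple of \<open>1 / width m\<close> on a strip of area \<open>4 * \<epsilon> * width k\<close>. Those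
  after it, which may be arbitrarily steep there, are bounded through their \<open>L\<^sup>1\<close> norm on the
  ball.\<close>

lemma series_probe_le:
  assumes \<epsilon>: "0 < \<epsilon>"
  obtains X C where "\<And>k. d k = i \<Longrightarrow> t k = s \<Longrightarrow> strip i z \<epsilon> s (width k) \<subseteq> ball 0 1 \<Longrightarrow>
    (LINT x|lebesgue_on (ball 0 1). series d t [i, i] x * probe i z \<epsilon> s (width k) x)
      \<le> amp k * (X * width k + 208 * \<epsilon> * (real k * (1 / 2) ^ k) + 2 * C * (1 / 2) ^ k
                  - exp (- 8) * \<epsilon> / 4)"
proof -
  let ?M = "lebesgue_on (ball (0 :: real^2) 1)"
  let ?b = "\<lambda>m. block (d m) (t m) (width m)"
  obtain C where C0: "0 \<le> C" and C: "\<And>d t r a. 0 < r \<Longrightarrow> r \<le> 1 \<Longrightarrow> \<bar>t\<bar> \<le> 1 \<Longrightarrow> length a \<le> 2 \<Longrightarrow>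
       (LINT x|?M. \<bar>iter_partial a (block d t r) x\<bar>) \<le> C"
    by (rule integral_block_bounded) blast
  obtain X where X: "\<And>r. 0 < r \<Longrightarrow>
      (LINT x|lborel. iter_partial [i, i] (block i s r) x * probe i z \<epsilon> s r x)
        \<le> - (exp (- 8) * \<epsilon> / 4 - X * r)"
    by (rule integral_block_probe_le[OF \<epsilon>]) blast
  have "(LINT x|?M. series d t [i, i] x * probe i z \<epsilon> s (width k) x)
      \<le> amp k * (X * width k + 208 * \<epsilon> * (real k * (1 / 2) ^ k) + 2 * C * (1 / 2) ^ k
                  - exp (- 8) * \<epsilon> / 4)"
    if k: "d k = i" "t k = s" and sub: "strip i z \<epsilon> s (width k) \<subseteq> ball 0 1" for k
  proof -
    define \<phi> where "\<phi> = probe i z \<epsilon> s (width k)"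
    define S where "S = strip i z \<epsilon> s (width k)"
    define J where "J m = (LINT x|?M. iter_partial [i, i] (?b m) x * \<phi> x)" for m
    have test: "test_function (ball 0 1) \<phi>"
      unfolding \<phi>_def by (rule test_function_probe[OF \<epsilon> width_pos sub])
    have \<phi>0: "\<phi> x = 0" if "x \<notin> S" for x
      using probe_eq_0[OF \<epsilon> width_pos] that unfolding \<phi>_def S_def by blast
    have cont: "continuous_on UNIV (\<lambda>x. iter_partial [i, i] (?b m) x * \<phi> x)" for m
      unfolding \<phi>_def
      by (intro continuous_intros smooth_continuous smooth_iter_partial smooth_block smooth_probe)
    have J_eq: "J m = (LINT x|lborel. iter_partial [i, i] (?b m) x * \<phi> x)" for m
    proof -
      have "\<phi> x = 0" if "x \<notin> ball 0 1" for x
        using \<phi>0 that sub unfolding S_def by blast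
      then show ?thesis
        unfolding J_def by (intro integral_lebesgue_on_compact_support cont) simp_all
    qed
    have J_k: "J k \<le> X * width k - exp (- 8) * \<epsilon> / 4"
      unfolding J_eq using X[OF width_pos[of k]] k by (simp add: \<phi>_def)
    have J_before: "J m \<le> 104 * \<epsilon> * width k / width m" for m
    proof -
      have "J m \<le> (LINT x|lborel. 26 / width m * indicator S x)"
        unfolding J_eq
      proof (rule integral_mono')
        show "integrable lborel (\<lambda>x. 26 / width m * indicator S x)"
          unfolding S_def using \<epsilon> width_pos[of k]
          by (intro integrable_mult_right integral_indicator_strip(2)) auto
        fix x :: "real^2"
        show "0 \<le> 26 / width m * indicator S x"
          using width_pos[of m] by simp
        show "iter_partial [i, i] (?b m) x * \<phi> x \<le> 26 / width m * indicator S x"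
        proof (cases "x \<in> S")
          case True
          have "\<bar>iter_partial [i, i] (?b m) x\<bar> \<le> 13 * (lor ((x $ other (d m) - t m) / width m) / width m)"
            using abs_partial2_block_le[OF width_pos] by (simp add: iter_partial_Cons)
          also have "\<dots> \<le> 13 * (1 / width m)"
            using width_pos[of m] by (intro mult_left_mono divide_right_mono lor_le_1) auto
          finally have "\<bar>iter_partial [i, i] (?b m) x\<bar> * \<phi> x \<le> 13 * (1 / width m) * 2"
            unfolding \<phi>_def using width_pos[of m]
            by (intro mult_mono probe_le_2 probe_nonneg) auto
          moreover have "iter_partial [i, i] (?b m) x * \<phi> x \<le> \<bar>iter_partial [i, i] (?b m) x\<bar> * \<phi> x"
            unfolding \<phi>_def by (intro mult_right_mono probe_nonneg) simp
          ultimately show ?thesis using True by simp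
        qed (simp add: \<phi>0)
      qed
      also have "\<dots> = 26 / width m * (4 * \<epsilon> * width k)"
        unfolding S_def using \<epsilon> width_pos[of k] by (simp only: integral_mult_right_zero integral_indicator_strip less_imp_le)
      finally show ?thesis by simp
    qed
    have J_after: "J m \<le> 2 * C" for m
    proof -
      have int: "integrable ?M (\<lambda>x. 2 * \<bar>iter_partial [i, i] (?b m) x\<bar>)"
        by (intro integrable_mult_right integrable_abs integrable_on_ball smooth_continuous
            smooth_iter_partial smooth_block)
      have "J m \<le> (LINT x|?M. 2 * \<bar>iter_partial [i, i] (?b m) x\<bar>)"
        unfolding J_def
      proof (rule integral_mono'[OF int])
        fix x
        have "iter_partial [i, i] (?b m) x * \<phi> x \<le> \<bar>iter_partial [i, i] (?b m) x\<bar> * \<phi> x"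
          unfolding \<phi>_def by (intro mult_right_mono probe_nonneg) simp
        also have "\<dots> \<le> \<bar>iter_partial [i, i] (?b m) x\<bar> * 2"
          unfolding \<phi>_def by (intro mult_left_mono probe_le_2) simp
        finally show "iter_partial [i, i] (?b m) x * \<phi> x \<le> 2 * \<bar>iter_partial [i, i] (?b m) x\<bar>"
          by simp
      qed simp
      also have "\<dots> \<le> 2 * C"
        using C[OF width_pos width_le_1 t, of "[i, i]"] by simp
      finally show ?thesis .
    qed
    have sums: "(\<lambda>m. amp m * J m) sums (LINT x|?M. series d t [i, i] x * \<phi> x)"
      unfolding J_def by (rule series_test_sums[OF _ test]) simp
    then have split: "(LINT x|?M. series d t [i, i] x * \<phi> x)
        = (\<Sum>m<k. amp m * J m) + amp k * J k + (\<Sum>j. amp (j + Suc k) * J (j + Suc k))"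
      using suminf_split_initial_segment[OF sums_summable[OF sums], of "Suc k"] sums_unique[OF sums]
      by simp
    have "(\<Sum>m<k. amp m * J m) \<le> (\<Sum>m<k. 104 * \<epsilon> * (width k * (amp m / width m)))"
    proof (intro sum_mono)
      fix m
      have "amp m * J m \<le> amp m * (104 * \<epsilon> * width k / width m)"
        using amp_pos[of m] by (intro mult_left_mono J_before) simp
      then show "amp m * J m \<le> 104 * \<epsilon> * (width k * (amp m / width m))"
        by (simp add: ac_simps)
    qed
    also have "\<dots> = 104 * \<epsilon> * (width k * (\<Sum>m<k. amp m / width m))"
      by (simp only: sum_distrib_left)
    also have "\<dots> \<le> 104 * \<epsilon> * (amp k * (2 * real k * (1 / 2) ^ k))"
      using \<epsilon> by (intro mult_left_mono width_sum_le) simp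
    finally have 1: "(\<Sum>m<k. amp m * J m) \<le> 104 * \<epsilon> * (amp k * (2 * real k * (1 / 2) ^ k))" .
    have 2: "amp k * J k \<le> amp k * (X * width k - exp (- 8) * \<epsilon> / 4)"
      using amp_pos[of k] by (intro mult_left_mono J_k) simp
    have "(\<Sum>j. amp (j + Suc k) * J (j + Suc k)) \<le> (\<Sum>j. amp (j + Suc k) * (2 * C))"
    proof (rule suminf_le)
      show "amp (j + Suc k) * J (j + Suc k) \<le> amp (j + Suc k) * (2 * C)" for j
        using amp_pos[of "j + Suc k"] by (intro mult_left_mono J_after) simp
      show "summable (\<lambda>j. amp (j + Suc k) * J (j + Suc k))"
        by (rule summable_ignore_initial_segment[OF sums_summable[OF sums]])
      show "summable (\<lambda>j. amp (j + Suc k) * (2 * C))"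
        by (rule summable_ignore_initial_segment[OF summable_cmult_amp])
    qed
    also have "\<dots> = (\<Sum>j. amp (j + Suc k)) * (2 * C)"
      by (rule suminf_mult2[symmetric, OF summable_ignore_initial_segment[OF summable_amp]])
    also have "\<dots> \<le> amp k * (1 / 2) ^ k * (2 * C)"
      using C0 by (intro mult_right_mono suminf_amp_tail_le) simp
    finally have 3: "(\<Sum>j. amp (j + Suc k) * J (j + Suc k)) \<le> amp k * (1 / 2) ^ k * (2 * C)" .
    have "(LINT x|?M. series d t [i, i] x * \<phi> x)
        \<le> 104 * \<epsilon> * (amp k * (2 * real k * (1 / 2) ^ k))
          + amp k * (X * width k - exp (- 8) * \<epsilon> / 4) + amp k * (1 / 2) ^ k * (2 * C)"
      unfolding split by (intro add_mono 1 2 3)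
    also have "\<dots> = amp k * (X * width k + 208 * \<epsilon> * (real k * (1 / 2) ^ k) + 2 * C * (1 / 2) ^ k
                  - exp (- 8) * \<epsilon> / 4)"
      by (simp add: algebra_simps)
    finally show ?thesis unfolding \<phi>_def .
  qed
  then show ?thesis by (rule that)
qed

lemma width_tendsto_0: "width \<longlonglongrightarrow> 0"
proof (rule tendsto_sandwich[OF _ _ tendsto_const LIMSEQ_realpow_zero[of "1 / 2"]])
  show "\<forall>\<^sub>F k in sequentially. width k \<le> (1 / 2) ^ k"
  proof (intro always_eventually allI)
    fix k :: nat
    show "width k \<le> (1 / 2) ^ k"
      unfolding width_def by (intro power_decreasing) (cases k, auto intro: self_le_power)
  qed
qed (use width_pos in \<open>auto simp: less_imp_le\<close>)

text \<open>With the threshold \<open>\<Lambda> = width k powr (- 1 / 2)\<close> the two terms \<open>\<Lambda> * width k\<close> and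
  \<open>\<Lambda> powr (1 - q)\<close> of the lower bound are positive powers of \<open>width k\<close>, whatever \<open>q > 1\<close> is.\<close>

lemma neg_part_weak_deriv_not_Lp:
  assumes freq: "\<exists>\<^sub>F k in sequentially. d k = i \<and> t k = s"
    and z: "z \<in> \<Omega>'" "z $ other i = s" and \<Omega>': "open \<Omega>'" "\<Omega>' \<subseteq> ball 0 1"
    and q: "1 < q" and g: "weak_deriv (ball 0 1) [i, i] (series d t []) g"
  shows "\<not> in_Lp \<Omega>' q (neg_part g)"
proof
  assume Lp: "in_Lp \<Omega>' q (neg_part g)"
  obtain e where e: "0 < e" "ball z e \<subseteq> \<Omega>'"
    using \<Omega>'(1) z(1) open_contains_ball by blast
  define \<epsilon> where "\<epsilon> = e / 4"
  have \<epsilon>: "0 < \<epsilon>" using e by (simp add: \<epsilon>_def)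
  have strip_sub: "strip i (z $ i) \<epsilon> s r \<subseteq> \<Omega>'" if "r \<le> \<epsilon>" for r
  proof
    fix x assume x: "x \<in> strip i (z $ i) \<epsilon> s r"
    have "norm (x - z) \<le> (\<Sum>j\<in>UNIV. \<bar>(x - z) $ j\<bar>)"
      by (rule norm_le_l1_cart)
    also have "\<dots> \<le> \<epsilon> + \<epsilon>"
      using x that z(2) by (simp add: sum_2_other[of _ i] strip_def)
    also have "\<dots> < e" using e by (simp add: \<epsilon>_def)
    finally show "x \<in> \<Omega>'"
      using e(2) by (auto simp: dist_norm norm_minus_commute)
  qed
  obtain X C where up: "\<And>k. d k = i \<Longrightarrow> t k = s \<Longrightarrow> strip i (z $ i) \<epsilon> s (width k) \<subseteq> ball 0 1 \<Longrightarrow>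
    (LINT x|lebesgue_on (ball 0 1). series d t [i, i] x * probe i (z $ i) \<epsilon> s (width k) x)
      \<le> amp k * (X * width k + 208 * \<epsilon> * (real k * (1 / 2) ^ k) + 2 * C * (1 / 2) ^ k
                  - exp (- 8) * \<epsilon> / 4)"
    by (rule series_probe_le[OF \<epsilon>]) blast
  define I where "I = (LINT x|lebesgue_on \<Omega>'. \<bar>neg_part g x\<bar> powr q)"
  define E where "E k = X * width k + 208 * \<epsilon> * (real k * (1 / 2) ^ k) + 2 * C * (1 / 2) ^ k
      + 8 * \<epsilon> * (width k powr (1 / 2) / amp k) + 2 * I * (width k powr ((q - 1) / 2) / amp k)" for k
  have "E \<longlonglongrightarrow> X * 0 + 208 * \<epsilon> * 0 + 2 * C * 0 + 8 * \<epsilon> * 0 + 2 * I * 0"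
    unfolding E_def[abs_def]
    by (intro tendsto_add tendsto_mult_left width_tendsto_0 width_powr_over_amp_tendsto_0
        LIMSEQ_realpow_zero powser_times_n_limit_0) (use q in auto)
  then have "E \<longlonglongrightarrow> 0" by simp
  then have E_small: "\<forall>\<^sub>F k in sequentially. E k < exp (- 8) * \<epsilon> / 4"
    using \<epsilon> by (intro order_tendstoD) auto
  have width_small: "\<forall>\<^sub>F k in sequentially. width k < \<epsilon>"
    using \<epsilon> by (intro order_tendstoD[OF width_tendsto_0])
  from frequently_eventually_conj[OF freq eventually_conj[OF E_small width_small]]
  obtain k where k: "d k = i" "t k = s" "E k < exp (- 8) * \<epsilon> / 4" "width k < \<epsilon>"
    by (auto dest!: frequently_ex)
  let ?\<phi> = "probe i (z $ i) \<epsilon> s (width k)"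
  let ?S = "strip i (z $ i) \<epsilon> s (width k)"
  have sub: "?S \<subseteq> \<Omega>'" using k by (intro strip_sub) simp
  have test: "test_function (ball 0 1) ?\<phi>"
    by (rule test_function_probe[OF \<epsilon> width_pos order_trans[OF sub \<Omega>'(2)]])
  have eq: "(LINT x|lebesgue_on (ball 0 1). g x * ?\<phi> x)
      = (LINT x|lebesgue_on (ball 0 1). series d t [i, i] x * ?\<phi> x)"
    using g weak_deriv_series[of "[i, i]"] test unfolding weak_deriv_def by simp
  define \<Lambda> where "\<Lambda> = width k powr (- (1 / 2))"
  have \<Lambda>1: "\<Lambda> * width k = width k powr (1 / 2)"
  proof -
    have "\<Lambda> * width k = width k powr (- (1 / 2)) * width k powr 1"
      using width_pos[of k] by (simp add: \<Lambda>_def)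
    then show ?thesis by (simp only: powr_add[symmetric]) simp
  qed
  have \<Lambda>2: "\<Lambda> powr (1 - q) = width k powr ((q - 1) / 2)"
  proof -
    have "- (1 / 2) * (1 - q) = (q - 1) / 2" by (simp add: field_simps)
    then show ?thesis unfolding \<Lambda>_def powr_powr by (simp only:)
  qed
  have "- (2 * (\<Lambda> * measure lborel ?S + \<Lambda> powr (1 - q) * I))
      \<le> (LINT x|lebesgue_on (ball 0 1). g x * ?\<phi> x)"
    unfolding I_def
  proof (rule integral_ge_of_neg_part_Lp[OF _ Lp q _ _ compact_strip sub \<Omega>'(2)])
    show "loc_integrable (ball 0 1) g" using g unfolding weak_deriv_def by blast
    show "0 < \<Lambda>" using width_pos[of k] by (simp add: \<Lambda>_def)
    show "continuous_on UNIV ?\<phi>" by (intro smooth_continuous smooth_probe)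
    show "?\<phi> x = 0" if "x \<notin> ?S" for x by (rule probe_eq_0[OF \<epsilon> width_pos that])
    show "\<Omega>' \<in> sets lebesgue" using \<Omega>'(1) by simp
  qed (auto simp: probe_nonneg probe_le_2)
  also have "\<dots> \<le> amp k * (X * width k + 208 * \<epsilon> * (real k * (1 / 2) ^ k) + 2 * C * (1 / 2) ^ k
                  - exp (- 8) * \<epsilon> / 4)"
    unfolding eq by (rule up[OF k(1,2) order_trans[OF sub \<Omega>'(2)]])
  finally have "amp k * (exp (- 8) * \<epsilon> / 4) \<le> amp k * (X * width k + 208 * \<epsilon> * (real k * (1 / 2) ^ k)
      + 2 * C * (1 / 2) ^ k) + 2 * (\<Lambda> * measure lborel ?S + \<Lambda> powr (1 - q) * I)"
    by (simp add: algebra_simps)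
  also have "\<Lambda> * measure lborel ?S = 4 * \<epsilon> * width k powr (1 / 2)"
    using measure_strip[of \<epsilon> "width k" i "z $ i" s] \<epsilon> width_pos[of k] by (simp flip: \<Lambda>1)
  also have "amp k * (X * width k + 208 * \<epsilon> * (real k * (1 / 2) ^ k) + 2 * C * (1 / 2) ^ k)
      + 2 * (4 * \<epsilon> * width k powr (1 / 2) + \<Lambda> powr (1 - q) * I) = amp k * E k"
    unfolding E_def \<Lambda>2 using amp_pos[of k] by (simp add: field_simps)
  finally have "exp (- 8) * \<epsilon> / 4 \<le> E k"
    using amp_pos[of k] by simp
  with k(3) show False by simp
qed

end

text \<open>An enumeration of triples whose third component is a dummy natural number visits every pair of
  the first two components infinitely often.\<close>

lemma exists_recurrent_enumeration:
  obtains d :: "nat \<Rightarrow> 2" and t :: "nat \<Rightarrow> real"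
  where "\<And>m. \<bar>t m\<bar> \<le> 1"
    and "\<And>i s. s \<in> \<rat> \<Longrightarrow> \<bar>s\<bar> \<le> 1 \<Longrightarrow> \<exists>\<^sub>F k in sequentially. d k = i \<and> t k = s"
proof -
  define c :: "nat \<Rightarrow> bool \<times> rat \<times> nat" where "c = from_nat"
  define d :: "nat \<Rightarrow> 2" where "d k = (if fst (c k) then 1 else 2)" for k
  define t :: "nat \<Rightarrow> real" where
    "t k = (let s = real_of_rat (fst (snd (c k))) in if \<bar>s\<bar> \<le> 1 then s else 0)" for k
  have "\<exists>\<^sub>F k in sequentially. d k = i \<and> t k = s" if s: "s \<in> \<rat>" "\<bar>s\<bar> \<le> 1" for i s
  proof -
    obtain p where p: "s = real_of_rat p"
      using s(1) by (auto elim: Rats_cases)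
    have surj: "c (to_nat (i = 1, p, n)) = (i = 1, p, n)" for n
      by (simp add: c_def)
    have "inj (\<lambda>n. to_nat (i = 1, p, n :: nat))"
      by (auto intro!: injI)
    then have "infinite (range (\<lambda>n. to_nat (i = 1, p, n :: nat)))"
      by (rule range_inj_infinite)
    moreover have "d (to_nat (i = 1, p, n)) = i" for n :: nat
      unfolding d_def surj using exhaust_2[of i] by auto
    moreover have "t (to_nat (i = 1, p, n)) = s" for n :: nat
      unfolding t_def surj using s(2) by (simp add: p)
    ultimately have "infinite (range (\<lambda>n. to_nat (i = 1, p, n :: nat)))"
      "range (\<lambda>n. to_nat (i = 1, p, n :: nat)) \<subseteq> {k. d k = i \<and> t k = s}"
      by auto
    then have "infinite {k. d k = i \<and> t k = s}"
      using finite_subset by blast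
    then show ?thesis
      by (simp add: cofinite_eq_sequentially[symmetric] frequently_cofinite)
  qed
  moreover have "\<bar>t m\<bar> \<le> 1" for m
    by (simp add: t_def Let_def)
  ultimately show ?thesis using that by blast
qed

lemma open_meets_rational_line:
  fixes \<Omega>' :: "(real^2) set"
  assumes "open \<Omega>'" "\<Omega>' \<noteq> {}" "\<Omega>' \<subseteq> ball 0 1"
  obtains z where "z \<in> \<Omega>'" "z $ j \<in> \<rat>" "\<bar>z $ j\<bar> \<le> 1"
proof -
  obtain y e where y: "0 < e" "ball y e \<subseteq> \<Omega>'"
    using assms(1,2) open_contains_ball by blast
  obtain s where s: "s \<in> \<rat>" "y $ j < s" "s < y $ j + e"
    using Rats_dense_in_real[of "y $ j" "y $ j + e"] y(1) by auto
  define z where "z = y + (s - y $ j) *\<^sub>R axis j 1"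
  have "dist y z < e"
    using s by (simp add: z_def dist_norm norm_axis_1)
  then have z: "z \<in> \<Omega>'" using y(2) by auto
  have "z $ j = s" by (simp add: z_def axis_def)
  moreover have "\<bar>z $ j\<bar> \<le> 1"
  proof -
    have "z \<in> ball 0 1" using z assms(3) by blast
    then show ?thesis using component_le_norm_cart[of z j] by simp
  qed
  ultimately show ?thesis using that z s(1) by simp
qed

theorem theorem3p2:
  "\<exists>u :: real^2 \<Rightarrow> real.
     (\<exists>L. L-lipschitz_on (ball 0 1) u) \<and>
     distr_subharmonic (ball 0 1) u \<and>
     sobolev 2 1 (ball 0 1) u \<and>
     (\<forall>\<Omega>' q i g. open \<Omega>' \<and> \<Omega>' \<noteq> {} \<and> \<Omega>' \<subseteq> ball 0 1 \<and> 1 < q \<and>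
        weak_deriv (ball 0 1) [i, i] u g \<longrightarrow> \<not> in_Lp \<Omega>' q (neg_part g))"
proof -
  obtain d :: "nat \<Rightarrow> 2" and t :: "nat \<Rightarrow> real"
    where t: "\<And>m. \<bar>t m\<bar> \<le> 1"
      and freq: "\<And>i s. s \<in> \<rat> \<Longrightarrow> \<bar>s\<bar> \<le> 1 \<Longrightarrow> \<exists>\<^sub>F k in sequentially. d k = i \<and> t k = s"
    by (rule exists_recurrent_enumeration) blast
  show ?thesis
  proof (intro exI[of _ "series d t []"] conjI allI impI)
    show "\<exists>L. L-lipschitz_on (ball 0 1) (series d t [])"
      by (rule exI, rule lipschitz_series[OF t])
    show "distr_subharmonic (ball 0 1) (series d t [])"
      by (rule distr_subharmonic_series[OF t])
    show "sobolev 2 1 (ball 0 1) (series d t [])"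
      by (rule sobolev_series[OF t])
    fix \<Omega>' :: "(real^2) set" and q :: real and i :: 2 and g :: "real^2 \<Rightarrow> real"
    assume *: "open \<Omega>' \<and> \<Omega>' \<noteq> {} \<and> \<Omega>' \<subseteq> ball 0 1 \<and> 1 < q \<and>
        weak_deriv (ball 0 1) [i, i] (series d t []) g"
    obtain z where z: "z \<in> \<Omega>'" "z $ other i \<in> \<rat>" "\<bar>z $ other i\<bar> \<le> 1"
      by (rule open_meets_rational_line[of \<Omega>' "other i"]) (use * in blast)+
    show "\<not> in_Lp \<Omega>' q (neg_part g)"
      using * by (intro neg_part_weak_deriv_not_Lp[OF t freq[OF z(2,3)] z(1) refl]) auto
  qed
qed

end
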